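(* Let $I=(\mathcal{L}(u,v))\subset S=k[x_1,\ldots,x_n]$ be a lexsegment ideal defined by monomials $u=x_1x_l^{a_l}\cdots x_n^{a_n}$ and $v=x_q^{b_q}\cdots x_n^{b_n}$ of degree $d\ge 2$, where $a_l,b_q>0$, $l,q\geq 2$, and $x_n u/x_1<_{lex} v$. Then the following statements hold: (a) If $v=x_2^d$ and $l\geq 4$, then $\mathrm{depth}(S/I)=l-2$. (b) If $v=x_2^{d-1}x_j$ for some $3\leq j\leq n-2$ and $l\geq j+2$, then $\mathrm{depth}(S/I)=l-j$. (c) $\mathrm{depth}(S/I)=1$ in all the other cases.
   Context: $S=k[x_1,\ldots,x_n]$ is a polynomial ring over a field $k$, with monomials ordered lexicographically with $x_1>x_2>\cdots>x_n$. $d\geq 2$ is an integer and $\mathcal{M}_d$ is the set of monomials of degree $d$ in $S$. For $u,v\in\mathcal{M}_d$ with $u\geq_{lex}v$, $\mathcal{L}(u,v)=\{w\in\mathcal{M}_d : u\geq_{lex}w\geq_{lex}v\}$; the ideal it generates is a lexsegment ideal. Depth is taken with respect to the graded maximal ideal $(x_1,\ldots,x_n)$. *)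

theory Defs
  imports
    "HOL-Library.Poly_Mapping"
    "HOL-Library.Extended_Nat"
    "HOL-Algebra.Ideal"
    "HOL-Algebra.QuotRing"
    "HOL-Algebra.Module"
begin

text \<open>
  A monomial is its exponent vector \<open>w :: nat \<Rightarrow>\<^sub>0 nat\<close>, written additively: the product
  of two monomials is the sum of the exponent vectors, and \<open>Poly_Mapping.single i e\<close> is
  \<open>x\<^sub>i\<close> to the power \<open>e\<close>. Variables are indexed by \<open>1, \<dots>, n\<close>. A polynomial is a finitely
  supported map from monomials to the field, with the convolution product of
  \<open>Poly_Mapping\<close>.

  The library order on \<open>nat \<Rightarrow>\<^sub>0 nat\<close> compares two exponent vectors at the smallest index at
  which they differ, so it is the lexicographic order with \<open>x\<^sub>1 > x\<^sub>2 > \<dots> > x\<^sub>n\<close>.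
\<close>

type_synonym monom = "nat \<Rightarrow>\<^sub>0 nat"
type_synonym 'k mpoly = "monom \<Rightarrow>\<^sub>0 'k"

lemma monom_less_iff:
  "(u :: monom) < v \<longleftrightarrow>
     (\<exists>k. Poly_Mapping.lookup u k < Poly_Mapping.lookup v k \<and>
      (\<forall>i<k. Poly_Mapping.lookup u i = Poly_Mapping.lookup v i))"
  by transfer (simp add: less_fun_def)

definition monomials :: "nat \<Rightarrow> nat \<Rightarrow> monom set"
  where "monomials n d =
    {w. Poly_Mapping.keys w \<subseteq> {1..n} \<and> (\<Sum>i\<in>Poly_Mapping.keys w. Poly_Mapping.lookup w i) = d}"

definition lexsegment :: "nat \<Rightarrow> nat \<Rightarrow> monom \<Rightarrow> monom \<Rightarrow> monom set"
  where "lexsegment n d u v = {w \<in> monomials n d. v \<le> w \<and> w \<le> u}"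

definition poly_ring :: "nat \<Rightarrow> 'k::field mpoly ring"
  where "poly_ring n =
    \<lparr>carrier = {p. \<forall>w\<in>Poly_Mapping.keys p. Poly_Mapping.keys w \<subseteq> {1..n}},
     mult = (*), one = 1, zero = 0, add = (+)\<rparr>"

definition monom_ideal :: "nat \<Rightarrow> monom set \<Rightarrow> 'k::field mpoly set"
  where "monom_ideal n W = Idl\<^bsub>poly_ring n\<^esub> ((\<lambda>w. Poly_Mapping.single w 1) ` W)"

definition graded_max_ideal :: "nat \<Rightarrow> 'k::field mpoly set"
  where "graded_max_ideal n = monom_ideal n ((\<lambda>i. Poly_Mapping.single i 1) ` {1..n})"

text \<open>\<open>R/I\<close> as an \<open>R\<close>-module.\<close>

definition quot_module :: "('a, 'c) ring_scheme \<Rightarrow> 'a set \<Rightarrow> ('a, 'a set) module"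
  where "quot_module R I =
    ring.extend (R Quot I) \<lparr>smult = (\<lambda>r X. (I +>\<^bsub>R\<^esub> r) \<otimes>\<^bsub>R Quot I\<^esub> X)\<rparr>"

text \<open>The submodule \<open>JM\<close> of \<open>M\<close>.\<close>

definition ideal_smult :: "('a, 'c) ring_scheme \<Rightarrow> ('a, 'b, 'm) module_scheme \<Rightarrow> 'a set \<Rightarrow> 'b set"
  where "ideal_smult R M J =
    \<Inter>{N. submodule N R M \<and> (\<forall>r\<in>J. \<forall>x\<in>carrier M. r \<odot>\<^bsub>M\<^esub> x \<in> N)}"

text \<open>
  A list \<open>f\<^sub>1, \<dots>, f\<^sub>r\<close> is an \<open>M\<close>-sequence if each \<open>f\<^sub>i\<close> is a nonzerodivisor on
  \<open>M/(f\<^sub>1, \<dots>, f\<^bsub>i-1\<^esub>)M\<close> and \<open>M/(f\<^sub>1, \<dots>, f\<^sub>r)M\<close> is nonzero; both conditions are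
  stated in \<open>M\<close> rather than in the quotients.
\<close>

definition regular_sequence ::
  "('a, 'c) ring_scheme \<Rightarrow> ('a, 'b, 'm) module_scheme \<Rightarrow> 'a list \<Rightarrow> bool"
  where "regular_sequence R M fs \<longleftrightarrow>
    set fs \<subseteq> carrier R \<and>
    (\<forall>i<length fs. \<forall>x\<in>carrier M.
      fs ! i \<odot>\<^bsub>M\<^esub> x \<in> ideal_smult R M (Idl\<^bsub>R\<^esub> (set (take i fs))) \<longrightarrow>
      x \<in> ideal_smult R M (Idl\<^bsub>R\<^esub> (set (take i fs)))) \<and>
    ideal_smult R M (Idl\<^bsub>R\<^esub> (set fs)) \<noteq> carrier M"

text \<open>
  The supremum is taken in \<open>enat\<close>, so that an equation \<open>depth R J M = enat r\<close> includes
  that the lengths of the \<open>M\<close>-sequences in \<open>J\<close> are bounded.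
\<close>

definition depth :: "('a, 'c) ring_scheme \<Rightarrow> 'a set \<Rightarrow> ('a, 'b, 'm) module_scheme \<Rightarrow> enat"
  where "depth R J M = (SUP fs \<in> {fs. set fs \<subseteq> J \<and> regular_sequence R M fs}. enat (length fs))"

lemma keys_mult_subset:
  fixes p r :: "'k::field mpoly"
  assumes "\<forall>w\<in>Poly_Mapping.keys p. Poly_Mapping.keys w \<subseteq> A"
    "\<forall>w\<in>Poly_Mapping.keys r. Poly_Mapping.keys w \<subseteq> A"
    "w \<in> Poly_Mapping.keys (p * r)"
  shows "Poly_Mapping.keys w \<subseteq> A"
proof -
  from keys_mult[of p r] assms(3)
  obtain s t where "w = s + t" "s \<in> Poly_Mapping.keys p" "t \<in> Poly_Mapping.keys r"
    by blast
  then show ?thesis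
    using assms(1,2) keys_add[of s t] by blast
qed

lemma cring_poly_ring: "cring (poly_ring n :: 'k::field mpoly ring)"
proof (rule cringI)
  show "abelian_group (poly_ring n :: 'k mpoly ring)"
  proof (rule abelian_groupI)
    fix p r :: "'k mpoly"
    assume "p \<in> carrier (poly_ring n)" "r \<in> carrier (poly_ring n)"
    then show "p \<oplus>\<^bsub>poly_ring n\<^esub> r \<in> carrier (poly_ring n)"
      using keys_add[of p r] by (auto simp: poly_ring_def)
  next
    fix p :: "'k mpoly"
    assume "p \<in> carrier (poly_ring n)"
    then show "\<exists>y\<in>carrier (poly_ring n). y \<oplus>\<^bsub>poly_ring n\<^esub> p = \<zero>\<^bsub>poly_ring n\<^esub>"
      by (intro bexI[of _ "- p"]) (auto simp: poly_ring_def)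
  qed (auto simp: poly_ring_def add_ac)
  show "comm_monoid (poly_ring n :: 'k mpoly ring)"
    by (rule comm_monoidI)
       (auto simp: poly_ring_def algebra_simps dest: keys_mult_subset[rotated 2])
qed (auto simp: poly_ring_def distrib_right)

lemma carrier_quot_module [simp]: "carrier (quot_module R I) = carrier (R Quot I)"
  and add_quot_module [simp]: "add (quot_module R I) = add (R Quot I)"
  and zero_quot_module [simp]: "zero (quot_module R I) = zero (R Quot I)"
  and smult_quot_module [simp]: "smult (quot_module R I) r X = (I +>\<^bsub>R\<^esub> r) \<otimes>\<^bsub>R Quot I\<^esub> X"
  by (simp_all add: quot_module_def ring.defs FactRing_def)

lemma module_quot_module:
  assumes "cring R" "ideal I R"
  shows "module R (quot_module R I)"
proof -
  interpret R: cring R by fact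
  interpret I: ideal I R by fact
  interpret Q: cring "R Quot I"
    by (rule I.quotient_is_cring) fact
  interpret h: ring_hom_ring R "R Quot I" "(+>\<^bsub>R\<^esub>) I"
    by (rule I.rcos_ring_hom_ring)
  have ab: "abelian_group (quot_module R I)"
  proof (rule abelian_groupI, goal_cases)
    case (6 X)
    then show ?case
      by (intro bexI[of _ "\<ominus>\<^bsub>R Quot I\<^esub> X"])
         (simp_all only: carrier_quot_module add_quot_module zero_quot_module
            Q.l_neg Q.a_inv_closed)
  qed (simp_all only: carrier_quot_module add_quot_module zero_quot_module
         Q.a_closed Q.zero_closed Q.a_ac Q.l_zero Q.r_zero)
  have one: "I +>\<^bsub>R\<^esub> \<one>\<^bsub>R\<^esub> = \<one>\<^bsub>R Quot I\<^esub>"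
    by (rule h.hom_one)
  show ?thesis
  proof (rule moduleI, goal_cases)
    case 1
    show ?case by fact
  next
    case 2
    show ?case by (rule ab)
  next
    case (3 r X)
    then show ?case
      unfolding carrier_quot_module smult_quot_module
      by (intro Q.m_closed h.hom_closed)
  next
    case (4 r s X)
    then show ?case
      unfolding carrier_quot_module smult_quot_module add_quot_module
      by (simp only: h.hom_add Q.l_distr h.hom_closed)
  next
    case (5 r X Y)
    then show ?case
      unfolding carrier_quot_module smult_quot_module add_quot_module
      by (simp only: Q.r_distr h.hom_closed)
  next
    case (6 r s X)
    then show ?case
      unfolding carrier_quot_module smult_quot_module
      by (simp only: h.hom_mult Q.m_assoc h.hom_closed)
  next
    case (7 X)
    then show ?case
      unfolding carrier_quot_module smult_quot_module one
      by (rule Q.l_one)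
  qed
qed

end

theory Submission
  imports Defs
begin

text \<open>
  \<^emph>\<open>Upper bound.\<close> If a monomial \<open>e\<close> outside \<open>I\<close> has as annihilator modulo \<open>I\<close> the prime generated by the
  variables outside a set \<open>Y\<close>, then \<open>depth (S/I) \<le> card Y\<close>: on the module generated by \<open>e\<close>, which is a
  polynomial ring in \<open>card Y\<close> variables, more than \<open>card Y\<close> polynomials satisfy an algebraic relation
  over \<open>k\<close>, while the power products of a regular sequence \<open>f\<^sub>1, \<dots>, f\<^sub>s\<close> applied to an element that
  is nonzero after localization are linearly independent: divide the element by \<open>f\<^sub>1\<close> as often as
  possible and pass to the quotient by \<open>f\<^sub>1\<close>.

  With \<open>u = x\<^sub>1 u'\<close>, the monomial \<open>e\<close> is \<open>x\<^sub>1 (u'/x\<^sub>2)\<close> if \<open>l = 2\<close>, it is \<open>x\<^sub>2\<^bsup>d-1\<^esup>\<close> if \<open>l \<ge> 3\<close> and \<open>v\<close>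
  is at most \<open>x\<^sub>2\<^bsup>d-1\<^esup>x\<^sub>n\<close>, and otherwise \<open>v = x\<^sub>2\<^bsup>d-1\<^esup>x\<^sub>j\<close> and \<open>e = x\<^sub>1x\<^sub>2\<^bsup>d-1\<^esup>m\<close>, where \<open>m\<close> is \<open>x\<^sub>n\<^bsup>d-2\<^esup>\<close> for
  \<open>l \<le> j\<close> and \<open>u'/x\<^sub>l\<close> for \<open>l > j\<close>. The set \<open>Y\<close> is \<open>{1}\<close> in the first two cases and
  \<open>{1} \<union> {j+1, \<dots>, l-1}\<close> in the last one.

  \<^emph>\<open>Lower bound.\<close> The condition \<open>x\<^sub>n u' < v\<close> implies that no monomial outside \<open>I\<close> is multiplied into
  \<open>I\<close> by both \<open>x\<^sub>1\<close> and \<open>x\<^sub>n\<close>, so that \<open>x\<^sub>1 - x\<^sub>n\<close> is regular on \<open>S/I\<close>. In the last case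
  \<open>x\<^bsub>j+1\<^esub>, \<dots>, x\<^bsub>l-1\<^esub>\<close> do not occur in the generators and may be put in front.
\<close>

section \<open>Regular sequences on quotients by ideals\<close>

context cring
begin

text \<open>Two representatives of a coset of \<open>I\<close> differ by an element of
  \<open>I\<close>, hence of \<open>K\<close>, so membership in \<open>K\<close> does not depend on
  the representative.\<close>

lemma rcos_mem_rcos_image_iff:
  assumes "ideal I R" "ideal K R" "I \<subseteq> K" "p \<in> carrier R"
  shows "I +> p \<in> (+>) I ` K \<longleftrightarrow> p \<in> K"
proof
  interpret I: ideal I R by fact
  interpret K: ideal K R by fact
  assume "I +> p \<in> (+>) I ` K"
  then obtain k where k: "k \<in> K" "I +> p = I +> k" by blast
  have "p \<in> I +> k"
    using I.a_rcos_self[OF assms(4)] k(2) by simp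
  then obtain i where "i \<in> I" "p = i \<oplus> k"
    unfolding a_r_coset_def' by blast
  then show "p \<in> K"
    using k(1) assms(3) K.a_closed by blast
qed blast

lemma genideal_Un_genideal:
  assumes "A \<subseteq> carrier R" "B \<subseteq> carrier R"
  shows "Idl (A \<union> Idl B) = Idl (A \<union> B)"
proof
  have cB: "Idl B \<subseteq> carrier R"
    by (rule ideal.axioms(1)[OF genideal_ideal[OF assms(2)], THEN additive_subgroup.a_subset])
  have AB: "A \<union> B \<subseteq> Idl (A \<union> B)" using assms by (intro genideal_self) auto
  then have "Idl B \<subseteq> Idl (A \<union> B)"
    using assms by (intro genideal_minimal genideal_ideal) auto
  then show "Idl (A \<union> Idl B) \<subseteq> Idl (A \<union> B)"
    using assms AB by (intro genideal_minimal genideal_ideal) auto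
  have "A \<union> B \<subseteq> Idl (A \<union> Idl B)"
    using genideal_self[of "A \<union> Idl B"] genideal_self[OF assms(2)] assms cB by auto
  then show "Idl (A \<union> B) \<subseteq> Idl (A \<union> Idl B)"
    using assms cB by (intro genideal_minimal genideal_ideal) auto
qed

lemma mem_genideal_insert_iff:
  assumes K: "ideal K R" and f: "f \<in> carrier R"
  shows "p \<in> Idl (insert f K) \<longleftrightarrow> (\<exists>x\<in>K. \<exists>c\<in>carrier R. p = x \<oplus> c \<otimes> f)"
proof -
  have "K \<subseteq> carrier R"
    by (rule ideal.axioms(1)[OF K, THEN additive_subgroup.a_subset])
  then have "Idl (insert f K) = K <+> PIdl f"
    using genideal_Un_genideal[of K "{f}"] union_genideal[OF K cgenideal_ideal[OF f]]
      cgenideal_eq_genideal[OF f] f by simp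
  then show ?thesis
    unfolding set_add_def' cgenideal_def by blast
qed

end

section \<open>Regular sequences on \<open>R/I\<close> in terms of ideals of
  \<open>R\<close>\<close>

lemma carrier_FactRing_eq_image:
  fixes R (structure)
  shows "carrier (R Quot I) = (+>) I ` carrier R"
  unfolding FactRing_def A_RCOSETS_def' partial_object.simps by blast

text \<open>The image is a submodule containing all products of \<open>J\<close> with
  \<open>R/I\<close>. Conversely, the coset of \<open>i \<oplus> j\<close> is that of
  \<open>j\<close>, which is \<open>j\<close> applied to the coset of \<open>\<one>\<close>, so it
  lies in every submodule containing these products.\<close>

lemma ideal_smult_quot_module:
  fixes R (structure)
  assumes R: "cring R" and I: "ideal I R" and J: "ideal J R"
  shows "ideal_smult R (quot_module R I) J = (+>) I ` (I <+>\<^bsub>R\<^esub> J)"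
proof
  interpret R: cring R by fact
  interpret I: ideal I R by fact
  interpret J: ideal J R by fact
  interpret M: module R "quot_module R I"
    using module_quot_module[OF R.is_cring I] .
  interpret h: ring_hom_ring R "R Quot I" "(+>) I"
    by (rule I.rcos_ring_hom_ring)
  have K: "ideal (I <+>\<^bsub>R\<^esub> J) R" by (rule R.add_ideals[OF I J])
  interpret K: ideal "I <+>\<^bsub>R\<^esub> J" R by (rule K)
  have IK: "I \<subseteq> I <+>\<^bsub>R\<^esub> J" and JK: "J \<subseteq> I <+>\<^bsub>R\<^esub> J"
    using R.union_genideal[OF I J] R.genideal_self[of "I \<union> J"] I.a_subset J.a_subset by auto
  have repr: "\<exists>p\<in>carrier R. X = I +> p" if "X \<in> carrier (quot_module R I)" for X
    using that carrier_FactRing_eq_image[of R I] by auto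
  have mult: "r \<odot>\<^bsub>quot_module R I\<^esub> (I +> p) = I +> (r \<otimes> p)"
    if "r \<in> carrier R" "p \<in> carrier R" for r p
    using h.hom_mult[OF that] by simp
  have "submodule ((+>) I ` (I <+>\<^bsub>R\<^esub> J)) R (quot_module R I)"
  proof (rule M.submoduleI)
    show "(+>) I ` (I <+>\<^bsub>R\<^esub> J) \<subseteq> carrier (quot_module R I)"
      using h.hom_closed K.a_subset by auto
    show "\<zero>\<^bsub>quot_module R I\<^esub> \<in> (+>) I ` (I <+>\<^bsub>R\<^esub> J)"
      using h.hom_zero K.zero_closed by (metis image_eqI zero_quot_module)
  next
    fix X assume "X \<in> (+>) I ` (I <+>\<^bsub>R\<^esub> J)"
    then obtain p where p: "p \<in> I <+>\<^bsub>R\<^esub> J" "X = I +> p" by blast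
    have pc: "p \<in> carrier R" using p(1) K.a_subset by blast
    have "X \<oplus>\<^bsub>quot_module R I\<^esub> (I +> (\<ominus> p)) = \<zero>\<^bsub>quot_module R I\<^esub>"
      using h.hom_add[OF pc R.a_inv_closed[OF pc]] h.hom_zero p(2) R.r_neg[OF pc]
      by simp
    then have "\<ominus>\<^bsub>quot_module R I\<^esub> X = I +> (\<ominus> p)"
      using h.hom_closed[OF pc] h.hom_closed[OF R.a_inv_closed[OF pc]] p(2)
      by (metis M.M.minus_equality M.M.a_comm carrier_quot_module)
    then show "\<ominus>\<^bsub>quot_module R I\<^esub> X \<in> (+>) I ` (I <+>\<^bsub>R\<^esub> J)"
      using K.a_inv_closed[OF p(1)] by blast
  next
    fix X Y assume "X \<in> (+>) I ` (I <+>\<^bsub>R\<^esub> J)" "Y \<in> (+>) I ` (I <+>\<^bsub>R\<^esub> J)"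
    then obtain p q where "p \<in> I <+>\<^bsub>R\<^esub> J" "X = I +> p" "q \<in> I <+>\<^bsub>R\<^esub> J" "Y = I +> q" by blast
    then show "X \<oplus>\<^bsub>quot_module R I\<^esub> Y \<in> (+>) I ` (I <+>\<^bsub>R\<^esub> J)"
      using h.hom_add[of p q] K.a_subset K.a_closed[of p q]
      by (metis (no_types, lifting) add_quot_module image_eqI subsetD)
  next
    fix r X assume r: "r \<in> carrier R" and "X \<in> (+>) I ` (I <+>\<^bsub>R\<^esub> J)"
    then obtain p where p: "p \<in> I <+>\<^bsub>R\<^esub> J" "X = I +> p" by blast
    then show "r \<odot>\<^bsub>quot_module R I\<^esub> X \<in> (+>) I ` (I <+>\<^bsub>R\<^esub> J)"
      using mult[OF r, of p] K.a_subset K.I_l_closed[OF p(1) r] by auto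
  qed
  moreover have "\<forall>r\<in>J. \<forall>x\<in>carrier (quot_module R I).
      r \<odot>\<^bsub>quot_module R I\<^esub> x \<in> (+>) I ` (I <+>\<^bsub>R\<^esub> J)"
  proof (intro ballI)
    fix r X assume r: "r \<in> J" and "X \<in> carrier (quot_module R I)"
    then obtain p where p: "p \<in> carrier R" "X = I +> p" using repr by blast
    show "r \<odot>\<^bsub>quot_module R I\<^esub> X \<in> (+>) I ` (I <+>\<^bsub>R\<^esub> J)"
      using mult[OF subsetD[OF J.a_subset r] p(1)] p(2) JK J.I_r_closed[OF r p(1)] by blast
  qed
  ultimately show "ideal_smult R (quot_module R I) J \<subseteq> (+>) I ` (I <+>\<^bsub>R\<^esub> J)"
    unfolding ideal_smult_def by blast
  show "(+>) I ` (I <+>\<^bsub>R\<^esub> J) \<subseteq> ideal_smult R (quot_module R I) J"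
    unfolding ideal_smult_def
  proof (intro subsetI InterI, clarify)
    fix p N assume N: "submodule N R (quot_module R I)"
      and JN: "\<forall>r\<in>J. \<forall>x\<in>carrier (quot_module R I). r \<odot>\<^bsub>quot_module R I\<^esub> x \<in> N"
      and "p \<in> I <+>\<^bsub>R\<^esub> J"
    then obtain i j where ij: "i \<in> I" "j \<in> J" "p = i \<oplus> j"
      unfolding set_add_def' by blast
    have jc: "j \<in> carrier R" and ic: "i \<in> carrier R"
      using ij J.a_subset I.a_subset by auto
    have "I +> p = (I +> i) \<oplus>\<^bsub>R Quot I\<^esub> (I +> j)"
      unfolding ij(3) by (rule h.hom_add[OF ic jc])
    also have "I +> i = \<zero>\<^bsub>R Quot I\<^esub>"
      unfolding FactRing_def ring.simps by (rule I.a_rcos_const[OF ij(1)])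
    also have "\<zero>\<^bsub>R Quot I\<^esub> \<oplus>\<^bsub>R Quot I\<^esub> (I +> j) = I +> j"
      by (rule h.S.l_zero[OF h.hom_closed[OF jc]])
    also have "\<dots> = j \<odot>\<^bsub>quot_module R I\<^esub> (I +> \<one>)"
      using mult[OF jc R.one_closed] jc by (simp only: R.r_one)
    also have "\<dots> \<in> N"
      using JN ij(2) h.hom_closed[OF R.one_closed] unfolding carrier_quot_module by blast
    finally show "I +> p \<in> N" .
  qed
qed

lemma ideal_smult_quot_module_genideal:
  fixes R (structure)
  assumes R: "cring R" and I: "ideal I R" and A: "A \<subseteq> carrier R"
  shows "ideal_smult R (quot_module R I) (Idl A) = (+>) I ` (Idl (I \<union> A))"
proof -
  interpret R: cring R by fact
  have "I \<subseteq> carrier R"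
    by (rule ideal.axioms(1)[OF I, THEN additive_subgroup.a_subset])
  then show ?thesis
    using ideal_smult_quot_module[OF R I R.genideal_ideal[OF A]]
      R.union_genideal[OF I R.genideal_ideal[OF A]] R.genideal_Un_genideal[of I A] A
    by metis
qed

text \<open>Regular sequences on \<open>R/K\<close>, written with ideals of \<open>R\<close> only:
  passing to the quotient by \<open>f\<close> enlarges \<open>K\<close>. The recursion permits
  induction on the list with \<open>K\<close> varying.\<close>

primrec reg_seq :: "('a, 'c) ring_scheme \<Rightarrow> 'a set \<Rightarrow> 'a list \<Rightarrow> bool"
  where
    "reg_seq R K [] \<longleftrightarrow> K \<noteq> carrier R"
  | "reg_seq R K (f # fs) \<longleftrightarrow> f \<in> carrier R \<and>
      (\<forall>p\<in>carrier R. f \<otimes>\<^bsub>R\<^esub> p \<in> K \<longrightarrow> p \<in> K) \<and> reg_seq R (Idl\<^bsub>R\<^esub> (insert f K)) fs"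

context cring
begin

text \<open>Adjoining \<open>f\<close> first and further elements later generates the same ideal as
  adjoining all at once, so position \<open>Suc i\<close> over \<open>K\<close> is position
  \<open>i\<close> over \<open>Idl (insert f K)\<close>.\<close>

lemma reg_seq_iff_nth:
  assumes "ideal K R"
  shows "reg_seq R K fs \<longleftrightarrow> set fs \<subseteq> carrier R \<and>
    (\<forall>i<length fs. \<forall>p\<in>carrier R. fs ! i \<otimes> p \<in> Idl (K \<union> set (take i fs)) \<longrightarrow>
      p \<in> Idl (K \<union> set (take i fs))) \<and>
    Idl (K \<union> set fs) \<noteq> carrier R"
  using assms
proof (induction fs arbitrary: K)
  case Nil
  interpret ideal K R by fact
  have "Idl K = K"
    using genideal_minimal[OF Nil] genideal_self[OF a_subset] by blast
  then show ?case by simp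
next
  case (Cons f fs)
  interpret ideal K R by fact
  have K: "Idl K = K"
    using genideal_minimal[OF Cons.prems] genideal_self[OF a_subset] by blast
  show ?case
  proof (cases "f \<in> carrier R \<and> set fs \<subseteq> carrier R")
    case False
    moreover have "reg_seq R L fs \<Longrightarrow> set fs \<subseteq> carrier R" for L
      by (induction fs arbitrary: L) auto
    ultimately show ?thesis by auto
  next
    case True
    have step: "Idl (Idl (insert f K) \<union> A) = Idl (K \<union> insert f A)" if "A \<subseteq> carrier R" for A
      using genideal_Un_genideal[of A "insert f K"] True that a_subset
      by (simp add: Un_commute)
    have take: "set (take i fs) \<subseteq> carrier R" for i
      using True by (meson order_trans set_take_subset)
    have id: "ideal (Idl (insert f K)) R"
      using True a_subset by (intro genideal_ideal) auto
    show ?thesis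
      unfolding reg_seq.simps Cons.IH[OF id] length_Cons All_less_Suc2
      using True by (auto simp: step take K)
  qed
qed

end

text \<open>Since \<open>ideal_smult\<close> is the image of an ideal containing \<open>I\<close>,
  each condition on a coset \<open>I +> p\<close> becomes membership of \<open>p\<close> in some
  \<open>Idl (I \<union> A)\<close>.\<close>

lemma regular_sequence_quot_module_iff:
  fixes R (structure)
  assumes R: "cring R" and I: "ideal I R"
  shows "regular_sequence R (quot_module R I) fs \<longleftrightarrow> reg_seq R I fs"
proof -
  interpret R: cring R by fact
  show ?thesis
  proof (cases "set fs \<subseteq> carrier R")
    case False
    then show ?thesis
      by (simp add: R.reg_seq_iff_nth[OF I] regular_sequence_def)
  next
    case True
    interpret I: ideal I R by fact
    interpret h: ring_hom_ring R "R Quot I" "(+>) I"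
      by (rule I.rcos_ring_hom_ring)
    have car: "carrier (quot_module R I) = (+>) I ` carrier R"
      by (simp add: carrier_FactRing_eq_image)
    have ids: "ideal (Idl (I \<union> A)) R" "I \<subseteq> Idl (I \<union> A)" if "A \<subseteq> carrier R" for A
      using R.genideal_ideal[of "I \<union> A"] R.genideal_self[of "I \<union> A"] I.a_subset that by auto
    have take: "set (take i fs) \<subseteq> carrier R" for i
      using True by (meson order_trans set_take_subset)
    have mem: "I +> p \<in> ideal_smult R (quot_module R I) (Idl A) \<longleftrightarrow> p \<in> Idl (I \<union> A)"
      if "A \<subseteq> carrier R" "p \<in> carrier R" for A p
      using R.rcos_mem_rcos_image_iff[OF I ids[OF that(1)] that(2)]
        ideal_smult_quot_module_genideal[OF R I that(1)] by simp
    have mult: "r \<odot>\<^bsub>quot_module R I\<^esub> (I +> p) = I +> (r \<otimes> p)"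
      if "r \<in> carrier R" "p \<in> carrier R" for r p
      using h.hom_mult[OF that] by simp
    have "(ideal_smult R (quot_module R I) (Idl (set fs)) \<noteq> carrier (quot_module R I)) \<longleftrightarrow>
        Idl (I \<union> set fs) \<noteq> carrier R"
    proof -
      interpret K: ideal "Idl (I \<union> set fs)" R using ids(1)[OF True] .
      have "ideal_smult R (quot_module R I) (Idl (set fs)) = carrier (quot_module R I) \<longleftrightarrow>
         (\<forall>p\<in>carrier R. I +> p \<in> ideal_smult R (quot_module R I) (Idl (set fs)))"
        using K.a_subset ideal_smult_quot_module_genideal[OF R I True]
        unfolding car by blast
      then show ?thesis
        using mem[OF True] K.a_subset by blast
    qed
    moreover have "(\<forall>x\<in>carrier (quot_module R I).
        fs ! i \<odot>\<^bsub>quot_module R I\<^esub> x \<in> ideal_smult R (quot_module R I) (Idl (set (take i fs))) \<longrightarrow>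
        x \<in> ideal_smult R (quot_module R I) (Idl (set (take i fs)))) \<longleftrightarrow>
      (\<forall>p\<in>carrier R. fs ! i \<otimes> p \<in> Idl (I \<union> set (take i fs)) \<longrightarrow> p \<in> Idl (I \<union> set (take i fs)))"
      if "i < length fs" for i
    proof -
      have fi: "fs ! i \<in> carrier R"
        using that True by (meson nth_mem subsetD)
      show ?thesis
        unfolding car ball_simps(9)
        by (intro ball_cong refl)
          (simp only: mult[OF fi] mem[OF take] R.m_closed[OF fi])
    qed
    ultimately show ?thesis
      unfolding R.reg_seq_iff_nth[OF I] regular_sequence_def
      using True by (simp cong: all_cong)
  qed
qed

section \<open>The polynomial ring is Noetherian\<close>

definition var_monoms :: "nat \<Rightarrow> monom set"
  where "var_monoms n = {w. Poly_Mapping.keys w \<subseteq> {1..n}}"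

lemma zero_in_var_monoms [simp]: "0 \<in> var_monoms n"
  by (simp add: var_monoms_def)

lemma single_in_var_monoms [simp]: "1 \<le> i \<Longrightarrow> i \<le> n \<Longrightarrow> Poly_Mapping.single i e \<in> var_monoms n"
  by (simp add: var_monoms_def)

lemma add_in_var_monoms_iff [simp]:
  "v + w \<in> var_monoms n \<longleftrightarrow> v \<in> var_monoms n \<and> w \<in> var_monoms n"
proof -
  have "Poly_Mapping.keys (v + w) = Poly_Mapping.keys v \<union> Poly_Mapping.keys w"
    by (auto simp: in_keys_iff lookup_add)
  then show ?thesis by (simp add: var_monoms_def)
qed

lemma lookup_eq_0_of_var_monoms: "w \<in> var_monoms n \<Longrightarrow> i = 0 \<or> n < i \<Longrightarrow> Poly_Mapping.lookup w i = 0"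
  unfolding var_monoms_def by (auto simp: subset_iff in_keys_iff)

lemma monom_add_diff:
  fixes v w :: monom
  assumes "\<And>i. Poly_Mapping.lookup v i \<le> Poly_Mapping.lookup w i"
  shows "v + (w - v) = w"
  by (rule poly_mapping_eqI) (simp add: lookup_add lookup_minus assms)

lemma carrier_poly_ring: "carrier (poly_ring n) = {p. Poly_Mapping.keys p \<subseteq> var_monoms n}"
  by (auto simp: poly_ring_def var_monoms_def)

lemma poly_ring_simps [simp]:
  "x \<oplus>\<^bsub>poly_ring n\<^esub> y = x + y" "x \<otimes>\<^bsub>poly_ring n\<^esub> y = x * y"
  "\<zero>\<^bsub>poly_ring n\<^esub> = 0" "\<one>\<^bsub>poly_ring n\<^esub> = 1"
  by (simp_all add: poly_ring_def)

context
  fixes n :: nat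
begin

interpretation S: cring "poly_ring n :: 'k::field mpoly ring"
  by (rule cring_poly_ring)

lemmas carrier_add = S.a_closed[simplified poly_ring_simps]
lemmas carrier_mult = S.m_closed[simplified poly_ring_simps]
lemmas carrier_zero = S.zero_closed[simplified poly_ring_simps]
lemmas carrier_one = S.one_closed[simplified poly_ring_simps]

lemma carrier_single: "w \<in> var_monoms n \<Longrightarrow> Poly_Mapping.single w (c :: 'k::field) \<in> carrier (poly_ring n)"
  by (simp add: carrier_poly_ring)

lemma carrier_uminus: "(p :: 'k::field mpoly) \<in> carrier (poly_ring n) \<Longrightarrow> - p \<in> carrier (poly_ring n)"
  by (simp add: carrier_poly_ring)

lemma carrier_diff:
  "(p :: 'k::field mpoly) \<in> carrier (poly_ring n) \<Longrightarrow> q \<in> carrier (poly_ring n) \<Longrightarrow> p - q \<in> carrier (poly_ring n)"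
  using carrier_add[of p "- q"] carrier_uminus[of q] by simp

lemma carrier_sum:
  "(\<And>x. x \<in> A \<Longrightarrow> f x \<in> carrier (poly_ring n)) \<Longrightarrow> (\<Sum>x\<in>A. f x :: 'k::field mpoly) \<in> carrier (poly_ring n)"
  by (induction A rule: infinite_finite_induct) (auto intro: carrier_add carrier_zero)

lemma carrier_power: "(p :: 'k::field mpoly) \<in> carrier (poly_ring n) \<Longrightarrow> p ^ e \<in> carrier (poly_ring n)"
  by (induction e) (auto intro: carrier_mult carrier_one)

lemmas carrier_intros = carrier_add carrier_mult carrier_zero carrier_one carrier_single
  carrier_uminus carrier_diff carrier_sum carrier_power

context
  fixes K :: "'k::field mpoly set"
  assumes K: "ideal K (poly_ring n)"
begin

interpretation K: ideal K "poly_ring n" by (rule K)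

lemma ideal_carrier: "p \<in> K \<Longrightarrow> p \<in> carrier (poly_ring n)"
  using K.a_subset by blast

lemma ideal_zero: "0 \<in> K"
  using K.zero_closed by simp

lemma ideal_add: "p \<in> K \<Longrightarrow> q \<in> K \<Longrightarrow> p + q \<in> K"
  using K.a_closed[of p q] by simp

lemma ideal_mult: "p \<in> K \<Longrightarrow> r \<in> carrier (poly_ring n) \<Longrightarrow> r * p \<in> K"
  using K.I_l_closed[of p r] by simp

lemma ideal_diff: "p \<in> K \<Longrightarrow> q \<in> K \<Longrightarrow> p - q \<in> K"
  using ideal_add[of p "- q"] ideal_mult[of q "- 1"] carrier_uminus[OF carrier_one[where ?'k = 'k]] by simp

lemma ideal_sum: "(\<And>x. x \<in> A \<Longrightarrow> f x \<in> K) \<Longrightarrow> (\<Sum>x\<in>A. f x) \<in> K"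
  by (induction A rule: infinite_finite_induct) (auto intro: ideal_add ideal_zero)

lemma ideal_add_cancel: "p \<in> K \<Longrightarrow> p + q \<in> K \<longleftrightarrow> q \<in> K"
  using ideal_add[of p q] ideal_diff[of "p + q" p] by auto

lemma mem_insert_poly_iff:
  "f \<in> carrier (poly_ring n) \<Longrightarrow>
    p \<in> Idl\<^bsub>poly_ring n\<^esub> (insert f K) \<longleftrightarrow> (\<exists>x\<in>K. \<exists>c\<in>carrier (poly_ring n). p = x + c * f)"
  using S.mem_genideal_insert_iff[OF K, of f p] by simp

end
end

lemma lookup_single_mult:
  fixes p :: "'k::field mpoly"
  shows "Poly_Mapping.lookup (Poly_Mapping.single v c * p) (v + w) = c * Poly_Mapping.lookup p w"
proof -
  \<comment> \<open>Moving the condition \<open>v = l\<close> to the outside lets the outer sum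
    collapse to a single index.\<close>
  have "(\<Sum>l. ((c when v = l) * (\<Sum>q. (Poly_Mapping.lookup p q when v + w = l + q)))) =
     (\<Sum>l. ((c * (\<Sum>q. (Poly_Mapping.lookup p q when v + w = l + q))) when v = l))"
    by (rule arg_cong[of _ _ Sum_any]) (auto simp: when_def)
  then show ?thesis
    by (simp add: lookup_mult lookup_single)
qed

lemma lookup_single_mult_eq_0:
  fixes p :: "'k::field mpoly"
  shows "(\<And>t. w \<noteq> v + t) \<Longrightarrow> Poly_Mapping.lookup (Poly_Mapping.single v c * p) w = 0"
  using keys_mult[of "Poly_Mapping.single v c" p]
  by (cases "c = 0") (auto simp flip: not_in_keys_iff_lookup_eq_zero)

lemma keys_single_mult:
  fixes p :: "'k::field mpoly"
  assumes "c \<noteq> 0"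
  shows "Poly_Mapping.keys (Poly_Mapping.single v c * p) = (+) v ` Poly_Mapping.keys p"
proof (intro subset_antisym subsetI)
  fix w assume w: "w \<in> Poly_Mapping.keys (Poly_Mapping.single v c * p)"
  then obtain t where "w = v + t"
    using lookup_single_mult_eq_0[of w v c p] by (auto simp: in_keys_iff)
  then show "w \<in> (+) v ` Poly_Mapping.keys p"
    using w by (auto simp: in_keys_iff lookup_single_mult)
next
  fix w assume "w \<in> (+) v ` Poly_Mapping.keys p"
  then show "w \<in> Poly_Mapping.keys (Poly_Mapping.single v c * p)"
    using assms by (auto simp: in_keys_iff lookup_single_mult)
qed

section \<open>Dickson's lemma and well-foundedness of the monomial order in finitely many
  variables\<close>

lemma mono_subseq_nat:
  fixes g :: "nat \<Rightarrow> nat"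
  shows "\<exists>\<phi> :: nat \<Rightarrow> nat. strict_mono \<phi> \<and> mono (\<lambda>i. g (\<phi> i))"
proof -
  obtain \<phi> :: "nat \<Rightarrow> nat" where \<phi>: "strict_mono \<phi>" "monoseq (\<lambda>i. g (\<phi> i))"
    using seq_monosub[of g] by blast
  show ?thesis
  proof (cases "mono (\<lambda>i. g (\<phi> i))")
    case True
    then show ?thesis using \<phi>(1) by blast
  next
    case False
    then have dec: "g (\<phi> j) \<le> g (\<phi> i)" if "i \<le> j" for i j
      using \<phi>(2) that unfolding monoseq_def mono_def by blast
    \<comment> \<open>A nonincreasing sequence of naturals is constant from a position of its
      minimum on, and a constant tail is monotone.\<close>
    define N where "N = (ARG_MIN (\<lambda>i. g (\<phi> i)) i. True)"
    have "g (\<phi> N) \<le> g (\<phi> i)" for i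
      unfolding N_def by (rule arg_min_nat_le) simp
    then have "g (\<phi> (N + i)) = g (\<phi> N)" for i
      using dec[of N "N + i"] by (simp add: antisym)
    then have "mono (\<lambda>i. g (\<phi> (N + i)))" by (simp add: mono_def)
    moreover have "strict_mono (\<lambda>i. \<phi> (N + i))"
      using \<phi>(1) by (simp add: strict_mono_def)
    ultimately show ?thesis by blast
  qed
qed

text \<open>A further subsequence keeps the coordinates already treated monotone, so they can be
  handled one at a time.\<close>

lemma dickson:
  fixes g :: "nat \<Rightarrow> 'a \<Rightarrow> nat"
  assumes "finite A"
  shows "\<exists>\<phi> :: nat \<Rightarrow> nat. strict_mono \<phi> \<and> (\<forall>a\<in>A. mono (\<lambda>i. g (\<phi> i) a))"
  using assms
proof induction
  case empty
  show ?case using strict_mono_id by blast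
next
  case (insert a A)
  then obtain \<phi> :: "nat \<Rightarrow> nat" where \<phi>: "strict_mono \<phi>" "\<forall>a\<in>A. mono (\<lambda>i. g (\<phi> i) a)" by blast
  obtain \<psi> :: "nat \<Rightarrow> nat" where \<psi>: "strict_mono \<psi>" "mono (\<lambda>i. g (\<phi> (\<psi> i)) a)"
    using mono_subseq_nat[of "\<lambda>i. g (\<phi> i) a"] by blast
  have "mono \<psi>" using \<psi>(1) by (rule strict_mono_mono)
  then have "\<forall>a\<in>A. mono (\<lambda>i. g (\<phi> (\<psi> i)) a)"
    using \<phi>(2) by (simp add: mono_def)
  then show ?case
    using \<phi>(1) \<psi> by (intro exI[of _ "\<phi> \<circ> \<psi>"]) (auto simp: strict_mono_def)
qed

lemma dickson_var_monoms:
  fixes w :: "nat \<Rightarrow> monom"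
  assumes "\<And>i. w i \<in> var_monoms n"
  shows "\<exists>i j. i < j \<and> (\<exists>t \<in> var_monoms n. w j = w i + t)"
proof -
  obtain \<phi> :: "nat \<Rightarrow> nat" where \<phi>: "strict_mono \<phi>" "\<forall>a\<in>{1..n}. mono (\<lambda>i. Poly_Mapping.lookup (w (\<phi> i)) a)"
    using dickson[of "{1..n}" "\<lambda>i. Poly_Mapping.lookup (w i)"] by auto
  have "Poly_Mapping.lookup (w (\<phi> 0)) a \<le> Poly_Mapping.lookup (w (\<phi> 1)) a" for a
  proof (cases "a \<in> {1..n}")
    case True
    then show ?thesis using \<phi>(2) by (auto simp: mono_def)
  next
    case False
    then show ?thesis
      using lookup_eq_0_of_var_monoms[OF assms, of a] by auto
  qed
  then have eq: "w (\<phi> 1) = w (\<phi> 0) + (w (\<phi> 1) - w (\<phi> 0))"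
    by (rule monom_add_diff[symmetric])
  then have "w (\<phi> 1) - w (\<phi> 0) \<in> var_monoms n"
    using assms[of "\<phi> 1"] by (metis add_in_var_monoms_iff)
  moreover have "\<phi> 0 < \<phi> 1" using \<phi>(1) by (simp add: strict_mono_def)
  ultimately show ?thesis using eq by blast
qed

lemma monom_zero_le: "(0 :: monom) \<le> w"
proof (rule ccontr)
  assume "\<not> 0 \<le> w"
  then have "w < 0" by simp
  then show False by (simp add: monom_less_iff)
qed

text \<open>An infinite descending chain would contain a monomial dividing a later one, but a
  divisor is never larger than its multiple. Fixing \<open>n\<close> matters:
  \<open>x1 > x2 > x3 > ...\<close> descends forever.\<close>

lemma wf_var_monoms: "wf {(v, w). v \<in> var_monoms n \<and> w \<in> var_monoms n \<and> v < w}"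
  unfolding wf_iff_no_infinite_down_chain
proof
  assume "\<exists>f. \<forall>i. (f (Suc i), f i) \<in> {(v, w). v \<in> var_monoms n \<and> w \<in> var_monoms n \<and> v < w}"
  then obtain f where f: "\<And>i. f i \<in> var_monoms n" "\<And>i. f (Suc i) < f i" by auto
  obtain i j t where ij: "i < j" "f j = f i + t"
    using dickson_var_monoms[of f n] f(1) by blast
  have "f j < f i" using ij(1) f(2) by (induction i j rule: less_Suc_induct) auto
  moreover have "f i \<le> f j" using add_left_mono[OF monom_zero_le[of t], of "f i"] ij(2) by simp
  ultimately show False by simp
qed

text \<open>Replacing each \<open>e t\<close> by an element of \<open>e t + (e i. i < t)\<close> with minimal leading monomial,
  Dickson's lemma yields two leading monomials one of which divides a later one.\<close>
lemma poly_ring_noetherian: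
  fixes e :: "nat \<Rightarrow> 'k::field mpoly"
  assumes e: "\<And>t. e t \<in> carrier (poly_ring n)"
  shows "\<exists>t. e t \<in> Idl\<^bsub>poly_ring n\<^esub> (e ` {..<t})"
proof (rule ccontr)
  assume neg: "\<not> ?thesis"
  interpret S: cring "poly_ring n :: 'k mpoly ring" by (rule cring_poly_ring)
  define J where "J t = Idl\<^bsub>poly_ring n\<^esub> (e ` {..<t})" for t
  define lm :: "'k mpoly \<Rightarrow> monom" where "lm p = Max (Poly_Mapping.keys p)" for p
  have idJ: "ideal (J t) (poly_ring n)" for t
    unfolding J_def using e by (intro S.genideal_ideal) auto
  have eJ: "e i \<in> J t" if "i < t" for i t
    using S.genideal_self[of "e ` {..<t}"] e that unfolding J_def by blast
  have J_mono: "J s \<subseteq> J t" if "s \<le> t" for s t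
    unfolding J_def[of s] using eJ that by (intro S.genideal_minimal idJ) auto
  \<comment> \<open>The coset \<open>e t + J t\<close> omits 0 because
    \<open>e t \<notin> J t\<close>, so its members have leading monomials, and one of these is
    minimal.\<close>
  have "\<exists>p. p - e t \<in> J t \<and> (\<forall>q. q - e t \<in> J t \<longrightarrow> \<not> lm q < lm p)" for t
  proof -
    define A where "A = {p. p - e t \<in> J t}"
    have car: "p \<in> carrier (poly_ring n)" "p \<noteq> 0" if "p \<in> A" for p
    proof -
      show "p \<in> carrier (poly_ring n)"
        using carrier_add[OF ideal_carrier[OF idJ] e, of "p - e t" t t] that by (simp add: A_def)
      show "p \<noteq> 0"
      proof
        assume "p = 0"
        then have "e t \<in> J t"
          using that ideal_diff[OF idJ ideal_zero[OF idJ], of "- e t" t] by (simp add: A_def)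
        then show False using neg by (auto simp: J_def)
      qed
    qed
    have lmc: "lm p \<in> var_monoms n" if "p \<in> A" for p
      using car[OF that] Max_in[of "Poly_Mapping.keys p"] unfolding lm_def carrier_poly_ring by auto
    have "lm (e t) \<in> lm ` A"
      using ideal_zero[OF idJ] by (simp add: A_def)
    then obtain z where z: "z \<in> lm ` A"
      "\<And>y. (y, z) \<in> {(v, w). v \<in> var_monoms n \<and> w \<in> var_monoms n \<and> v < w} \<Longrightarrow> y \<notin> lm ` A"
      by (rule wfE_min[OF wf_var_monoms[of n]]) blast
    then show ?thesis using lmc unfolding A_def by auto
  qed
  then obtain p where "\<forall>t. p t - e t \<in> J t \<and> (\<forall>q. q - e t \<in> J t \<longrightarrow> \<not> lm q < lm (p t))"
    using choice[of "\<lambda>t p. p - e t \<in> J t \<and> (\<forall>q. q - e t \<in> J t \<longrightarrow> \<not> lm q < lm p)"] by blast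
  then have p: "\<And>t. p t - e t \<in> J t" "\<And>t q. q - e t \<in> J t \<Longrightarrow> \<not> lm q < lm (p t)"
    by blast+
  have pc: "p t \<in> carrier (poly_ring n)" for t
    using carrier_add[OF ideal_carrier[OF idJ p(1)] e, of t t] by simp
  have nz: "q \<noteq> 0" if "q - e t \<in> J t" for q t
  proof
    assume "q = 0"
    then have "e t \<in> J t"
      using that ideal_diff[OF idJ ideal_zero[OF idJ], of "- e t" t] by simp
    then show False using neg by (auto simp: J_def)
  qed
  have lmk: "lm q \<in> Poly_Mapping.keys q" if "q \<noteq> 0" for q
    using that Max_in[of "Poly_Mapping.keys q"] unfolding lm_def by simp
  have lm_max: "w \<le> lm q" if "w \<in> Poly_Mapping.keys q" for w q
    using that unfolding lm_def by simp
  have "lm (p t) \<in> var_monoms n" for t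
    using lmk[OF nz[OF p(1)[of t]]] pc[of t] by (auto simp: carrier_poly_ring)
  then obtain i j v where ij: "i < j" "v \<in> var_monoms n" "lm (p j) = lm (p i) + v"
    using dickson_var_monoms[of "\<lambda>t. lm (p t)" n] by blast
  \<comment> \<open>\<open>c\<close> makes the leading term of the shifted \<open>p i\<close> cancel
    that of \<open>p j\<close>. As \<open>p i \<in> J j\<close>, the difference \<open>h\<close>
    stays in \<open>e j + J j\<close> and contradicts the minimality of \<open>p j\<close>.\<close>
  define c where "c = Poly_Mapping.lookup (p j) (lm (p j)) / Poly_Mapping.lookup (p i) (lm (p i))"
  have nzi: "Poly_Mapping.lookup (p i) (lm (p i)) \<noteq> 0"
    and nzj: "Poly_Mapping.lookup (p j) (lm (p j)) \<noteq> 0"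
    using lmk nz p(1) by (auto simp: in_keys_iff)
  have c0: "c \<noteq> 0" using nzi nzj by (simp add: c_def)
  define h where "h = p j - Poly_Mapping.single v c * p i"
  have pi: "p i \<in> J j"
  proof -
    have "p i - e i \<in> J j" using p(1)[of i] J_mono[of i j] ij(1) by auto
    then show ?thesis using ideal_add[OF idJ _ eJ[OF ij(1)]] by fastforce
  qed
  have "h - e j = (p j - e j) - Poly_Mapping.single v c * p i"
    by (simp add: h_def)
  also have "\<dots> \<in> J j"
    by (intro ideal_diff[OF idJ] p(1) ideal_mult[OF idJ] pi carrier_single ij)
  finally have hJ: "h - e j \<in> J j" .
  have "lm h < lm (p j)"
  proof -
    have hk: "lm h \<in> Poly_Mapping.keys h" using lmk[OF nz[OF hJ]] .
    have "lm h \<noteq> lm (p j)"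
    proof
      assume "lm h = lm (p j)"
      then have "Poly_Mapping.lookup h (v + lm (p i)) \<noteq> 0"
        using hk ij(3) by (simp add: in_keys_iff add.commute)
      then show False
        using ij(3) nzi by (simp add: h_def lookup_minus lookup_single_mult c_def add.commute)
    qed
    moreover have "lm h \<le> lm (p j)"
    proof -
      have "lm h \<in> Poly_Mapping.keys (p j) \<or> lm h \<in> Poly_Mapping.keys (Poly_Mapping.single v c * p i)"
        using hk by (auto simp: h_def in_keys_iff lookup_minus)
      then show ?thesis
        using lm_max[of _ "p j"] lm_max[of _ "p i"] ij(3)[unfolded add.commute[of _ v]]
        by (auto simp: keys_single_mult[OF c0] intro: add_left_mono)
    qed
    ultimately show ?thesis by simp
  qed
  then show False using p(2)[OF hJ] by simp
qed

section \<open>Power products of regular sequences\<close>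

text \<open>Negation is multiplication by \<open>- 1\<close>, so closure under it follows from
  \<open>mult\<close>.\<close>

lemma poly_ring_idealI:
  fixes K :: "'k::field mpoly set"
  assumes "K \<subseteq> carrier (poly_ring n)" "0 \<in> K"
    and add: "\<And>p q. p \<in> K \<Longrightarrow> q \<in> K \<Longrightarrow> p + q \<in> K"
    and mult: "\<And>r p. r \<in> carrier (poly_ring n) \<Longrightarrow> p \<in> K \<Longrightarrow> r * p \<in> K"
  shows "ideal K (poly_ring n)"
proof -
  interpret S: cring "poly_ring n :: 'k mpoly ring" by (rule cring_poly_ring)
  have "\<ominus>\<^bsub>poly_ring n\<^esub> p \<in> K" if "p \<in> K" for p
  proof -
    have "\<ominus>\<^bsub>poly_ring n\<^esub> p = - p"
      using that assms(1) carrier_uminus[of p n] by (intro S.minus_equality) auto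
    then show ?thesis
      using mult[of "- 1" p] that carrier_uminus[OF carrier_one[where ?'k = 'k]] by simp
  qed
  then have "subgroup K (add_monoid (poly_ring n))"
    using assms(1,2) add by (intro S.add.subgroupI) auto
  then show ?thesis
  proof (rule idealI[OF S.ring_axioms])
    fix p r assume "p \<in> K" "r \<in> carrier (poly_ring n :: 'k mpoly ring)"
    then show "r \<otimes>\<^bsub>poly_ring n\<^esub> p \<in> K" "p \<otimes>\<^bsub>poly_ring n\<^esub> r \<in> K"
      using mult[of r p] by (simp_all add: mult.commute)
  qed
qed

text \<open>The preimage in the polynomial ring of the extension of \<open>K\<close> to the localization
  at \<open>1 + m\<close>.\<close>
definition loc_ideal :: "nat \<Rightarrow> 'k::field mpoly set \<Rightarrow> 'k mpoly set \<Rightarrow> 'k mpoly set"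
  where "loc_ideal n m K = {p \<in> carrier (poly_ring n). \<exists>q\<in>m. (1 - q) * p \<in> K}"

lemma loc_idealI: "p \<in> carrier (poly_ring n) \<Longrightarrow> q \<in> m \<Longrightarrow> (1 - q) * p \<in> K \<Longrightarrow> p \<in> loc_ideal n m K"
  unfolding loc_ideal_def by blast

context
  fixes n :: nat and m K :: "'k::field mpoly set"
  assumes m: "ideal m (poly_ring n)" and K: "ideal K (poly_ring n)"
begin

lemma carrier_one_minus: "q \<in> m \<Longrightarrow> 1 - q \<in> carrier (poly_ring n)"
  by (intro carrier_intros ideal_carrier[OF m])

lemma one_minus_mult:
  assumes "q \<in> m" "r \<in> m"
  shows "\<exists>s\<in>m. (1 - q) * (1 - r) = 1 - s"
proof
  show "(1 - q) * (1 - r) = 1 - (q + (1 - q) * r)" by (simp add: algebra_simps)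
  show "q + (1 - q) * r \<in> m"
    by (intro ideal_add[OF m] ideal_mult[OF m] carrier_one_minus assms)
qed

text \<open>The elements \<open>1 - q\<close> become units in the localization; products of them
  have the same form.\<close>

lemma loc_ideal_one_minus:
  assumes "q \<in> m" "p \<in> carrier (poly_ring n)" "(1 - q) * p \<in> loc_ideal n m K"
  shows "p \<in> loc_ideal n m K"
proof -
  obtain r where r: "r \<in> m" "(1 - r) * ((1 - q) * p) \<in> K"
    using assms(3) by (auto simp: loc_ideal_def)
  then obtain s where "s \<in> m" "(1 - r) * (1 - q) = 1 - s"
    using one_minus_mult assms(1) by blast
  then show ?thesis
    using r assms(2) by (intro loc_idealI[of _ _ s]) (simp_all flip: mult.assoc)
qed

lemma ideal_loc_ideal: "ideal (loc_ideal n m K) (poly_ring n)"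
proof (rule poly_ring_idealI)
  show "loc_ideal n m K \<subseteq> carrier (poly_ring n)" by (auto simp: loc_ideal_def)
  show "0 \<in> loc_ideal n m K"
    using ideal_zero[OF m] ideal_zero[OF K] by (intro loc_idealI[of _ _ 0]) (auto intro: carrier_intros)
next
  fix p p' assume "p \<in> loc_ideal n m K" "p' \<in> loc_ideal n m K"
  then obtain q q' where *: "p \<in> carrier (poly_ring n)" "p' \<in> carrier (poly_ring n)"
      "q \<in> m" "q' \<in> m" "(1 - q) * p \<in> K" "(1 - q') * p' \<in> K"
    by (auto simp: loc_ideal_def)
  obtain s where s: "s \<in> m" "(1 - q) * (1 - q') = 1 - s"
    using one_minus_mult *(3,4) by blast
  have "(1 - s) * (p + p') = (1 - q') * ((1 - q) * p) + (1 - q) * ((1 - q') * p')"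
    unfolding s(2)[symmetric] by (simp add: algebra_simps)
  also have "\<dots> \<in> K"
    by (intro ideal_add[OF K] ideal_mult[OF K] carrier_one_minus *)
  finally show "p + p' \<in> loc_ideal n m K"
    using s(1) * by (intro loc_idealI[of _ _ s] carrier_intros)
next
  fix r p :: "'k mpoly" assume r: "r \<in> carrier (poly_ring n)" and "p \<in> loc_ideal n m K"
  then obtain q where q: "p \<in> carrier (poly_ring n)" "q \<in> m" "(1 - q) * p \<in> K"
    by (auto simp: loc_ideal_def)
  have "(1 - q) * (r * p) = r * ((1 - q) * p)" by (simp add: ac_simps)
  also have "\<dots> \<in> K" by (intro ideal_mult[OF K] q r)
  finally show "r * p \<in> loc_ideal n m K"
    using q r by (intro loc_idealI[of _ _ q] carrier_intros)
qed

lemma subset_loc_ideal: "K \<subseteq> loc_ideal n m K"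
  using ideal_zero[OF m] ideal_carrier[OF K] by (auto intro!: loc_idealI[of _ _ 0])

end

context
  fixes n :: nat and m K :: "'k::field mpoly set"
  assumes m: "ideal m (poly_ring n)" and K: "ideal K (poly_ring n)"
begin

text \<open>Otherwise repeated division of \<open>e\<close> by \<open>f\<close> gives a sequence in which, up to factors
  \<open>1 - q\<close>, every member divides its predecessor modulo \<open>K\<close>; such a sequence
  contradicts the ascending chain condition.\<close>
lemma exists_not_divisible:
  assumes f: "f \<in> m" and e: "e \<in> carrier (poly_ring n)" "e \<notin> loc_ideal n m K"
  shows "\<exists>q\<in>m. \<exists>x\<in>K. \<exists>t. \<exists>e'\<in>carrier (poly_ring n).
    (1 - q) * e = x + f ^ t * e' \<and> e' \<notin> loc_ideal n m (Idl\<^bsub>poly_ring n\<^esub> (insert f K))"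
proof (rule ccontr)
  assume neg: "\<not> ?thesis"
  interpret S: cring "poly_ring n :: 'k mpoly ring" by (rule cring_poly_ring)
  have fc: "f \<in> carrier (poly_ring n)" using ideal_carrier[OF m f] .
  \<comment> \<open>\<open>P\<close> collects the elements reached from \<open>e\<close> by dividing
    by powers of \<open>f\<close>, up to a factor \<open>1 - q\<close> and modulo \<open>K\<close>;
    \<open>Q\<close> below is a single division.\<close>
  define P where "P e' \<longleftrightarrow> e' \<in> carrier (poly_ring n) \<and> e' \<notin> loc_ideal n m K \<and>
     (\<exists>q\<in>m. \<exists>x\<in>K. \<exists>t. (1 - q) * e = x + f ^ t * e')" for e'
  define Q where "Q y z \<longleftrightarrow> (\<exists>q\<in>m. \<exists>x\<in>K. (1 - q) * y = x + f * z)" for y z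
  have P0: "P e"
    unfolding P_def using e ideal_zero[OF K] ideal_zero[OF m]
    by (intro conjI bexI[of _ 0] exI[of _ 0]) auto
  have step: "\<exists>z. P z \<and> Q y z" if "P y" for y
  proof -
    obtain q x t where y: "q \<in> m" "x \<in> K" "(1 - q) * e = x + f ^ t * y"
      "y \<in> carrier (poly_ring n)" "y \<notin> loc_ideal n m K"
      using \<open>P y\<close> unfolding P_def by blast
    then have "y \<in> loc_ideal n m (Idl\<^bsub>poly_ring n\<^esub> (insert f K))" using neg by blast
    then obtain q' where q': "q' \<in> m" "(1 - q') * y \<in> Idl\<^bsub>poly_ring n\<^esub> (insert f K)"
      by (auto simp: loc_ideal_def)
    then obtain x' z where x': "x' \<in> K" "z \<in> carrier (poly_ring n)" "(1 - q') * y = x' + z * f"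
      using mem_insert_poly_iff[OF K fc] by blast
    have z: "z \<notin> loc_ideal n m K"
    proof
      assume "z \<in> loc_ideal n m K"
      then have "f * z \<in> loc_ideal n m K" by (intro ideal_mult[OF ideal_loc_ideal[OF m K]] fc)
      then have "(1 - q') * y \<in> loc_ideal n m K"
        using x' subset_loc_ideal[OF m K] by (auto intro: ideal_add[OF ideal_loc_ideal[OF m K]] simp: mult.commute)
      then show False using loc_ideal_one_minus[OF m K q'(1) y(4)] y(5) by blast
    qed
    obtain s where s: "s \<in> m" "(1 - q') * (1 - q) = 1 - s"
      using one_minus_mult[OF m K] q'(1) y(1) by blast
    have "(1 - s) * e = (1 - q') * x + f ^ t * ((1 - q') * y)"
      unfolding s(2)[symmetric] mult.assoc y(3) by (simp add: algebra_simps)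
    also have "\<dots> = ((1 - q') * x + f ^ t * x') + f ^ Suc t * z"
      unfolding x'(3) by (simp add: algebra_simps)
    finally have "\<exists>q\<in>m. \<exists>x\<in>K. \<exists>t. (1 - q) * e = x + f ^ t * z"
      using s(1) by (intro bexI[of _ s] bexI[of _ "(1 - q') * x + f ^ t * x'"] exI[of _ "Suc t"])
        (auto intro!: ideal_add[OF K] ideal_mult[OF K] x' y carrier_one_minus[OF m K] q' carrier_power fc)
    then have "P z" unfolding P_def using z x'(2) by blast
    moreover have "Q y z"
      unfolding Q_def using q'(1) x'(1,3) by (metis mult.commute)
    ultimately show ?thesis by blast
  qed
  obtain E where E: "\<And>t. P (E t)" "\<And>t. Q (E t) (E (Suc t))"
    using dependent_nat_choice[of "\<lambda>_. P" "\<lambda>_. Q"] P0 step by metis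
  have Ec: "E t \<in> carrier (poly_ring n)" "E t \<notin> loc_ideal n m K" for t
    using E(1)[of t] unfolding P_def by auto
  obtain t where t: "E t \<in> Idl\<^bsub>poly_ring n\<^esub> (E ` {..<t})"
    using poly_ring_noetherian[of E n] Ec(1) by blast
  define L where "L = Idl\<^bsub>poly_ring n\<^esub> (insert (f * E t) K)"
  have fE: "f * E t \<in> carrier (poly_ring n)" by (intro carrier_mult fc Ec)
  have L: "ideal L (poly_ring n)"
    unfolding L_def using fE ideal_carrier[OF K] by (intro S.genideal_ideal) auto
  have LK: "K \<subseteq> L" "f * E t \<in> L"
    unfolding L_def using S.genideal_self[of "insert (f * E t) K"] fE ideal_carrier[OF K] by auto
  \<comment> \<open>Downward induction from \<open>t\<close>, with \<open>Suc d\<close> the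
    distance: up to factors \<open>1 - q\<close> and modulo \<open>K\<close>, every earlier
    \<open>E i\<close> is a multiple of \<open>f * E t\<close>.\<close>
  have EL: "i + Suc d = t \<Longrightarrow> E i \<in> loc_ideal n m L" for d i
  proof (induction d arbitrary: i)
    case 0
    obtain q x where q: "q \<in> m" "x \<in> K" "(1 - q) * E i = x + f * E t"
      using E(2)[of i] 0 unfolding Q_def by auto
    then have "(1 - q) * E i \<in> L" using LK by (auto intro: ideal_add[OF L])
    then show ?case using q(1) Ec(1) by (intro loc_idealI)
  next
    case (Suc d)
    obtain q x where q: "q \<in> m" "x \<in> K" "(1 - q) * E i = x + f * E (Suc i)"
      using E(2)[of i] unfolding Q_def by auto
    have "f * E (Suc i) \<in> loc_ideal n m L"
      using Suc by (intro ideal_mult[OF ideal_loc_ideal[OF m L]] fc) simp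
    then have "(1 - q) * E i \<in> loc_ideal n m L"
      using q LK subset_loc_ideal[OF m L] by (auto intro: ideal_add[OF ideal_loc_ideal[OF m L]])
    then show ?case using loc_ideal_one_minus[OF m L q(1) Ec(1)] by blast
  qed
  have "E i \<in> loc_ideal n m L" if "i < t" for i
    using EL[of i "t - Suc i"] that by simp
  then have "Idl\<^bsub>poly_ring n\<^esub> (E ` {..<t}) \<subseteq> loc_ideal n m L"
    by (intro S.genideal_minimal ideal_loc_ideal[OF m L]) auto
  then obtain q where q: "q \<in> m" "(1 - q) * E t \<in> L"
    using t unfolding loc_ideal_def by blast
  then obtain x c where x: "x \<in> K" "c \<in> carrier (poly_ring n)" "(1 - q) * E t = x + c * (f * E t)"
    unfolding L_def using mem_insert_poly_iff[OF K fE] by blast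
  \<comment> \<open>As in Nakayama's lemma: \<open>E t\<close> lies in \<open>f * E t\<close> up to
    a unit and modulo \<open>K\<close>, and \<open>f \<in> m\<close> makes the combined factor one
    minus an element of \<open>m\<close>.\<close>
  have "(1 - (q + c * f)) * E t = x" using x(3) by (simp add: algebra_simps)
  moreover have "q + c * f \<in> m" by (intro ideal_add[OF m] ideal_mult[OF m] q x f)
  ultimately have "E t \<in> loc_ideal n m K" using x(1) Ec(1) by (intro loc_idealI) auto
  then show False using Ec(2) by blast
qed

lemma power_mult_cancel:
  assumes "\<forall>p\<in>carrier (poly_ring n). f * p \<in> K \<longrightarrow> p \<in> K" "f \<in> carrier (poly_ring n)"
    "p \<in> carrier (poly_ring n)" "f ^ t * p \<in> K"
  shows "p \<in> K"
  using assms(4)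
proof (induction t)
  case (Suc t)
  have "f * (f ^ t * p) \<in> K" using Suc.prems by (simp add: mult.assoc)
  then show ?case
    using Suc.IH assms(1) carrier_mult[OF carrier_power[OF assms(2)] assms(3)] by blast
qed simp

end

section \<open>Linear independence of power products with bounded exponents\<close>

definition exponent_box :: "nat \<Rightarrow> nat \<Rightarrow> nat list set"
  where "exponent_box N s = {as. set as \<subseteq> {..N} \<and> length as = s}"

lemma finite_exponent_box: "finite (exponent_box N s)"
  unfolding exponent_box_def by (rule finite_lists_length_eq) simp

lemma card_exponent_box: "card (exponent_box N s) = Suc N ^ s"
  unfolding exponent_box_def by (simp add: card_lists_length_eq)

lemma sum_exponent_box_Suc:
  "(\<Sum>as\<in>exponent_box N (Suc s). g as) = (\<Sum>i\<le>N. \<Sum>as\<in>exponent_box N s. g (i # as))"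
proof -
  have "exponent_box N (Suc s) = (\<lambda>(i, as). i # as) ` ({..N} \<times> exponent_box N s)"
    by (auto simp: exponent_box_def length_Suc_conv image_iff)
  moreover have "inj_on (\<lambda>(i, as). i # as) ({..N} \<times> exponent_box N s)"
    by (auto simp: inj_on_def)
  ultimately show ?thesis
    by (simp add: sum.reindex sum.cartesian_product case_prod_unfold)
qed

definition power_product :: "'a::comm_monoid_mult list \<Rightarrow> nat list \<Rightarrow> 'a"
  where "power_product fs as = prod_list (map2 (^) fs as)"

lemma power_product_simps [simp]:
  "power_product [] as = 1"
  "power_product (f # fs) (i # as) = f ^ i * power_product fs as"
  by (simp_all add: power_product_def)

lemma carrier_power_product:
  "set fs \<subseteq> carrier (poly_ring n) \<Longrightarrow> (power_product fs as :: 'k::field mpoly) \<in> carrier (poly_ring n)"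
proof (induction fs arbitrary: as)
  case (Cons f fs)
  then show ?case
    by (cases as) (auto simp: power_product_def[of _ "[]"] intro: carrier_intros)
qed (simp add: carrier_one)

text \<open>The relation is a polynomial in the first element \<open>f\<close> with coefficients
  \<open>G i\<close> in the others. Dividing \<open>e\<close> by \<open>f\<close> as often as
  possible leaves an \<open>e'\<close> outside the localization of
  \<open>K' = Idl (insert f K)\<close>. Then the coefficients vanish in order of \<open>i\<close>:
  the lowest remaining one annihilates \<open>e'\<close> modulo \<open>K'\<close>, where the
  induction hypothesis applies.\<close>

lemma reg_seq_independent:
  fixes K :: "'k::field mpoly set"
  assumes "ideal m (poly_ring n)" "ideal K (poly_ring n)" "reg_seq (poly_ring n) K fs" "set fs \<subseteq> m"
    and "e \<in> carrier (poly_ring n)" "e \<notin> loc_ideal n m K"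
    and "(\<Sum>as\<in>exponent_box N (length fs). Poly_Mapping.single 0 (c as) * power_product fs as) * e \<in> K"
  shows "\<forall>as\<in>exponent_box N (length fs). c as = 0"
  using assms(2-)
proof (induction fs arbitrary: K e c)
  case Nil
  have box: "exponent_box N (length []) = {[]}" by (auto simp: exponent_box_def)
  have "e \<notin> K" using Nil.prems(5) subset_loc_ideal[OF assms(1) Nil.prems(1)] by blast
  have "c [] = 0"
  proof (rule ccontr)
    assume c: "c [] \<noteq> 0"
    have "Poly_Mapping.single 0 (inverse (c [])) * (Poly_Mapping.single 0 (c []) * e) \<in> K"
      using Nil.prems(6) unfolding box by (intro ideal_mult[OF Nil.prems(1), of "_ * e"] carrier_single) simp_all
    moreover have "Poly_Mapping.single 0 (inverse (c [])) * (Poly_Mapping.single 0 (c []) * e) = e"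
      using c by (simp add: mult_single flip: mult.assoc)
    ultimately have "e \<in> K" by simp
    then show False using \<open>e \<notin> K\<close> by simp
  qed
  then show ?case unfolding box by simp
next
  case (Cons f fs)
  interpret S: cring "poly_ring n :: 'k mpoly ring" by (rule cring_poly_ring)
  note m = assms(1) and K = Cons.prems(1)
  define K' where "K' = Idl\<^bsub>poly_ring n\<^esub> (insert f K)"
  have reg: "\<forall>p\<in>carrier (poly_ring n). f * p \<in> K \<longrightarrow> p \<in> K" "reg_seq (poly_ring n) K' fs"
    and fm: "f \<in> m" "set fs \<subseteq> m"
    using Cons.prems by (auto simp: K'_def)
  have fc: "f \<in> carrier (poly_ring n)" and fsc: "set fs \<subseteq> carrier (poly_ring n)"
    using fm ideal_carrier[OF m] by auto
  have K': "ideal K' (poly_ring n)"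
    unfolding K'_def using fc ideal_carrier[OF K] by (intro S.genideal_ideal) auto
  obtain q x t e' where e': "q \<in> m" "x \<in> K" "e' \<in> carrier (poly_ring n)"
    "(1 - q) * e = x + f ^ t * e'" "e' \<notin> loc_ideal n m K'"
    using exists_not_divisible[OF m K fm(1) Cons.prems(4,5)] unfolding K'_def by blast
  define G where "G i = (\<Sum>as\<in>exponent_box N (length fs).
    Poly_Mapping.single 0 (c (i # as)) * power_product fs as)" for i
  have Gc: "G i \<in> carrier (poly_ring n)" for i
    unfolding G_def by (intro carrier_sum carrier_mult carrier_single carrier_power_product fsc) simp
  have "(\<Sum>as\<in>exponent_box N (length (f # fs)). Poly_Mapping.single 0 (c as) * power_product (f # fs) as)
      = (\<Sum>i\<le>N. f ^ i * G i)"
    by (simp add: sum_exponent_box_Suc G_def sum_distrib_left ac_simps)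
  then have "(\<Sum>i\<le>N. f ^ i * G i) * e \<in> K"
    using Cons.prems(6) by (simp only:)
  then have "(1 - q) * ((\<Sum>i\<le>N. f ^ i * G i) * e) \<in> K"
    by (rule ideal_mult[OF K _ carrier_one_minus[OF m K e'(1)]])
  also have "(1 - q) * ((\<Sum>i\<le>N. f ^ i * G i) * e) = (\<Sum>i\<le>N. f ^ i * G i) * ((1 - q) * e)"
    by (simp only: ac_simps)
  also have "\<dots> = (\<Sum>i\<le>N. f ^ i * G i) * x + f ^ t * ((\<Sum>i\<le>N. f ^ i * G i) * e')"
    unfolding e'(4) by (simp add: algebra_simps)
  \<comment> \<open>The summand with \<open>x\<close> lies in \<open>K\<close>; the factor
    \<open>f ^ t\<close> is cancelled next, by regularity of \<open>f\<close>.\<close>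
  finally have "f ^ t * ((\<Sum>i\<le>N. f ^ i * G i) * e') \<in> K"
    by (subst (asm) ideal_add_cancel[OF K])
      (auto intro!: ideal_mult[OF K] e' carrier_sum carrier_mult carrier_power fc Gc)
  then have sumK: "(\<Sum>i\<le>N. f ^ i * G i) * e' \<in> K"
    by (rule power_mult_cancel[OF m K reg(1) fc, rotated])
      (intro carrier_mult carrier_sum carrier_power fc Gc e')
  have "i \<le> N \<Longrightarrow> \<forall>as\<in>exponent_box N (length fs). c (i # as) = 0" for i
  proof (induction i rule: less_induct)
    case (less i)
    have G0: "G j = 0" if "j < i" for j
      unfolding G_def using less that by (intro sum.neutral) auto
    have "(\<Sum>j\<le>N. f ^ j * G j) = (\<Sum>j\<in>{i..N}. f ^ j * G j)"
      using G0 by (intro sum.mono_neutral_right) auto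
    also have "\<dots> = f ^ i * (\<Sum>j\<in>{i..N}. f ^ (j - i) * G j)"
      unfolding sum_distrib_left
      by (intro sum.cong refl) (simp flip: mult.assoc power_add)
    also have "(\<Sum>j\<in>{i..N}. f ^ (j - i) * G j) = G i + f * (\<Sum>j\<in>{Suc i..N}. f ^ (j - Suc i) * G j)"
    proof -
      have "(\<Sum>j\<in>{Suc i..N}. f ^ (j - i) * G j) = (\<Sum>j\<in>{Suc i..N}. f * (f ^ (j - Suc i) * G j))"
        by (intro sum.cong refl) (simp flip: mult.assoc power_Suc add: Suc_diff_Suc)
      then show ?thesis
        using less.prems by (simp add: sum.atLeast_Suc_atMost sum_distrib_left)
    qed
    finally have "f ^ i * ((G i + f * (\<Sum>j\<in>{Suc i..N}. f ^ (j - Suc i) * G j)) * e') \<in> K"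
      using sumK by (simp add: ac_simps)
    then have "(G i + f * (\<Sum>j\<in>{Suc i..N}. f ^ (j - Suc i) * G j)) * e' \<in> K"
      by (rule power_mult_cancel[OF m K reg(1) fc, rotated])
        (intro carrier_add carrier_mult carrier_sum carrier_power fc Gc e')
    \<comment> \<open>The tail of the sum is a multiple of \<open>f\<close>, so only
      \<open>G i * e'\<close> remains modulo \<open>K'\<close>.\<close>
    then have "G i * e' \<in> K'"
      unfolding K'_def mem_insert_poly_iff[OF K fc]
      by (intro bexI[of _ "- ((\<Sum>j\<in>{Suc i..N}. f ^ (j - Suc i) * G j) * e')"]
           bexI[of _ "(G i + f * (\<Sum>j\<in>{Suc i..N}. f ^ (j - Suc i) * G j)) * e'"]
           carrier_uminus carrier_mult carrier_sum carrier_power fc Gc e')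
         (auto simp: algebra_simps)
    then show ?case
      using Cons.IH[OF K' reg(2) fm(2) e'(3,5), of "\<lambda>as. c (i # as)"] by (simp add: G_def)
  qed
  then show ?case by (auto simp: exponent_box_def length_Suc_conv)
qed

section \<open>Algebraic dependence by counting monomials\<close>

lemma exists_nontrivial_relation:
  fixes M :: "'a \<Rightarrow> 'b \<Rightarrow> 'k::field"
  assumes "finite T" "finite A" "card T < card A"
  shows "\<exists>c. (\<exists>a\<in>A. c a \<noteq> 0) \<and> (\<forall>t\<in>T. (\<Sum>a\<in>A. c a * M a t) = 0)"
  using assms
proof (induction T arbitrary: A M)
  case empty
  then obtain a where "a \<in> A" by fastforce
  then show ?case by (intro exI[of _ "\<lambda>_. 1"]) auto
next
  case (insert t T)
  show ?case
  proof (cases "\<forall>a\<in>A. M a t = 0")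
    case True
    obtain c where "\<exists>a\<in>A. c a \<noteq> 0" "\<forall>t\<in>T. (\<Sum>a\<in>A. c a * M a t) = 0"
      using insert.IH[of A M] insert.prems insert.hyps by auto
    then show ?thesis using True by (intro exI[of _ c]) auto
  next
    case False
    then obtain b where b: "b \<in> A" "M b t \<noteq> 0" by blast
    \<comment> \<open>Gaussian elimination with pivot \<open>M b t\<close>:
      \<open>M' a t = 0\<close> for all \<open>a\<close>, so only the conditions in \<open>T\<close>
      remain.\<close>
    define M' where "M' a s = M a s - M a t / M b t * M b s" for a s
    obtain c where c: "\<exists>a\<in>A - {b}. c a \<noteq> 0" "\<forall>s\<in>T. (\<Sum>a\<in>A - {b}. c a * M' a s) = 0"
    proof -
      have "card T < card (A - {b})"
        using insert.prems insert.hyps b(1) by (simp add: card_Diff_singleton)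
      then show ?thesis using insert.IH[of "A - {b}" M'] insert.prems(1) that by blast
    qed
    \<comment> \<open>The coefficient at \<open>b\<close> is chosen so that sums of \<open>M\<close>
      over \<open>A\<close> become sums of \<open>M'\<close> over \<open>A - {b}\<close>.\<close>
    define c' where "c' = c(b := - (\<Sum>a\<in>A - {b}. c a * (M a t / M b t)))"
    have sum: "(\<Sum>a\<in>A. c' a * M a s) = (\<Sum>a\<in>A - {b}. c a * M' a s)" for s
    proof -
      have "(\<Sum>a\<in>A. c' a * M a s) = c' b * M b s + (\<Sum>a\<in>A - {b}. c' a * M a s)"
        using b(1) insert.prems(1) by (simp add: sum.remove)
      also have "(\<Sum>a\<in>A - {b}. c' a * M a s) = (\<Sum>a\<in>A - {b}. c a * M a s)"
        by (intro sum.cong) (auto simp: c'_def)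
      finally show ?thesis
        by (simp add: c'_def M'_def right_diff_distrib sum_subtractf sum_distrib_right
          sum_distrib_left mult.assoc)
    qed
    have "(\<Sum>a\<in>A. c' a * M a s) = 0" if "s \<in> insert t T" for s
    proof (cases "s = t")
      case True
      then show ?thesis using b(2) by (simp add: sum M'_def)
    next
      case False
      then show ?thesis using that c(2) by (simp add: sum)
    qed
    moreover have "\<exists>a\<in>A. c' a \<noteq> 0" using c(1) by (auto simp: c'_def)
    ultimately show ?thesis by blast
  qed
qed

lemma card_bounded_monoms:
  assumes "finite Y"
  shows "finite {w :: monom. Poly_Mapping.keys w \<subseteq> Y \<and> (\<forall>i. Poly_Mapping.lookup w i \<le> D)}"
    and "card {w :: monom. Poly_Mapping.keys w \<subseteq> Y \<and> (\<forall>i. Poly_Mapping.lookup w i \<le> D)} \<le> Suc D ^ card Y"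
proof -
  define T where "T = {w :: monom. Poly_Mapping.keys w \<subseteq> Y \<and> (\<forall>i. Poly_Mapping.lookup w i \<le> D)}"
  have inj: "inj_on (\<lambda>w. restrict (Poly_Mapping.lookup w) Y) T"
  proof (rule inj_onI)
    fix v w assume "v \<in> T" "w \<in> T"
      and eq: "restrict (Poly_Mapping.lookup v) Y = restrict (Poly_Mapping.lookup w) Y"
    show "v = w"
    proof (rule poly_mapping_eqI)
      fix i
      show "Poly_Mapping.lookup v i = Poly_Mapping.lookup w i"
      proof (cases "i \<in> Y")
        case True
        then show ?thesis using fun_cong[OF eq, of i] by simp
      next
        case False
        then have "i \<notin> Poly_Mapping.keys v" "i \<notin> Poly_Mapping.keys w"
          using \<open>v \<in> T\<close> \<open>w \<in> T\<close> by (auto simp: T_def)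
        then show ?thesis by (simp add: not_in_keys_iff_lookup_eq_zero)
      qed
    qed
  qed
  have sub: "(\<lambda>w. restrict (Poly_Mapping.lookup w) Y) ` T \<subseteq> PiE Y (\<lambda>_. {..D})"
    by (auto simp: T_def)
  have fin: "finite (PiE Y (\<lambda>_. {..D}))" using assms by (simp add: finite_PiE)
  show "finite {w :: monom. Poly_Mapping.keys w \<subseteq> Y \<and> (\<forall>i. Poly_Mapping.lookup w i \<le> D)}"
    using inj_on_finite[OF inj sub fin] by (simp add: T_def)
  have "card T \<le> card (PiE Y (\<lambda>_. {..D}))" by (rule card_inj_on_le[OF inj sub fin])
  then show "card {w :: monom. Poly_Mapping.keys w \<subseteq> Y \<and> (\<forall>i. Poly_Mapping.lookup w i \<le> D)} \<le> Suc D ^ card Y"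
    using assms by (simp add: T_def card_PiE)
qed

lemma lookup_power_bound:
  fixes f :: "'k::field mpoly"
  assumes "\<forall>w\<in>Poly_Mapping.keys f. Poly_Mapping.lookup w i \<le> \<delta>" "w \<in> Poly_Mapping.keys (f ^ e)"
  shows "Poly_Mapping.lookup w i \<le> e * \<delta>"
  using assms(2)
proof (induction e arbitrary: w)
  case (Suc e)
  then show ?case
    using keys_mult[of f "f ^ e"] assms(1) by (fastforce simp: lookup_add intro: add_mono)
qed simp

lemma lookup_power_product_bound:
  fixes fs :: "'k::field mpoly list"
  assumes "\<forall>f\<in>set fs. \<forall>w\<in>Poly_Mapping.keys f. Poly_Mapping.lookup w i \<le> \<delta>"
    and "as \<in> exponent_box N (length fs)" "w \<in> Poly_Mapping.keys (power_product fs as)"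
  shows "Poly_Mapping.lookup w i \<le> N * \<delta> * length fs"
  using assms
proof (induction fs arbitrary: as w)
  case (Cons f fs)
  then obtain j bs where as: "as = j # bs" "j \<le> N" "bs \<in> exponent_box N (length fs)"
    by (auto simp: exponent_box_def length_Suc_conv)
  obtain v v' where v: "w = v + v'" "v \<in> Poly_Mapping.keys (f ^ j)"
      "v' \<in> Poly_Mapping.keys (power_product fs bs)"
    using Cons.prems(3) as(1) keys_mult[of "f ^ j" "power_product fs bs"] by auto
  have "Poly_Mapping.lookup v i \<le> j * \<delta>"
    using Cons.prems(1) v(2) by (intro lookup_power_bound[of f]) auto
  also have "\<dots> \<le> N * \<delta>" using as(2) by simp
  finally have "Poly_Mapping.lookup v i \<le> N * \<delta>" .
  moreover have "Poly_Mapping.lookup v' i \<le> N * \<delta> * length fs"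
    using Cons.prems(1) as(3) v(3) by (intro Cons.IH) auto
  ultimately show ?case by (simp add: v(1) lookup_add)
qed simp

text \<open>A box of \<open>(N + 1) ^ s\<close> power products maps to a space of dimension at most
  \<open>(N \<delta> s + 1) ^ card Y\<close>, which is smaller for large \<open>N\<close>.\<close>
lemma power_products_dependent:
  fixes fs :: "'k::field mpoly list"
  assumes Y: "finite Y" and less: "card Y < length fs"
  shows "\<exists>N c. (\<exists>as\<in>exponent_box N (length fs). c as \<noteq> 0) \<and>
    (\<forall>w. Poly_Mapping.keys w \<subseteq> Y \<longrightarrow> Poly_Mapping.lookup
      (\<Sum>as\<in>exponent_box N (length fs). Poly_Mapping.single 0 (c as) * power_product fs as) w = 0)"
proof -
  define s where "s = length fs"
  define V where "V = (\<Union>f\<in>set fs. \<Union>w\<in>Poly_Mapping.keys f. insert 0 (Poly_Mapping.range w))"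
  \<comment> \<open>\<open>\<delta>\<close> bounds all exponents occurring in \<open>fs\<close>; the
    inserted 0 keeps \<open>Max\<close> meaningful if \<open>V\<close> is empty.\<close>
  define \<delta> where "\<delta> = Max (insert 0 V)"
  have "finite V" by (simp add: V_def)
  moreover have "Poly_Mapping.lookup w i \<in> V" if "f \<in> set fs" "w \<in> Poly_Mapping.keys f" for f w i
  proof -
    have "Poly_Mapping.lookup w i \<in> insert 0 (Poly_Mapping.range w)"
      by (cases "i \<in> Poly_Mapping.keys w") (simp_all add: not_in_keys_iff_lookup_eq_zero)
    then show ?thesis using that unfolding V_def by blast
  qed
  ultimately have \<delta>: "\<forall>f\<in>set fs. \<forall>w\<in>Poly_Mapping.keys f. Poly_Mapping.lookup w i \<le> \<delta>" for i
    unfolding \<delta>_def by auto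
  define A where "A = Suc (\<delta> * s)"
  \<comment> \<open>With this choice
    \<open>(N * \<delta> * s + 1) ^ card Y \<le> N * (N + 1) ^ card Y\<close>, which is below
    \<open>(N + 1) ^ s\<close> because \<open>card Y < s\<close>.\<close>
  define N where "N = A ^ card Y"
  define T where "T = {w :: monom. Poly_Mapping.keys w \<subseteq> Y \<and> (\<forall>i. Poly_Mapping.lookup w i \<le> N * \<delta> * s)}"
  have "Suc (N * \<delta> * s) \<le> A * Suc N" by (simp add: A_def)
  then have "Suc (N * \<delta> * s) ^ card Y \<le> A ^ card Y * Suc N ^ card Y"
    by (metis power_mono power_mult_distrib zero_le)
  also have "\<dots> < Suc N * Suc N ^ card Y" by (simp add: N_def)
  also have "\<dots> \<le> Suc N ^ s"
    using less unfolding s_def power_Suc[symmetric] by (intro power_increasing) auto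
  finally have "card T < card (exponent_box N s)"
    using card_bounded_monoms(2)[OF Y, of "N * \<delta> * s"] by (simp add: T_def card_exponent_box)
  moreover have "finite T" unfolding T_def by (rule card_bounded_monoms(1)[OF Y])
  ultimately obtain c where c: "\<exists>as\<in>exponent_box N s. c as \<noteq> 0"
    "\<forall>w\<in>T. (\<Sum>as\<in>exponent_box N s. c as * Poly_Mapping.lookup (power_product fs as) w) = 0"
    using exists_nontrivial_relation[OF _ finite_exponent_box,
        of T N s "\<lambda>as. Poly_Mapping.lookup (power_product fs as)"] by blast
  have lk: "Poly_Mapping.lookup (\<Sum>as\<in>exponent_box N s. Poly_Mapping.single 0 (c as) * power_product fs as) w
      = (\<Sum>as\<in>exponent_box N s. c as * Poly_Mapping.lookup (power_product fs as) w)" for w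
    by (simp add: lookup_sum lookup_single_mult[of 0, simplified])
  have "Poly_Mapping.lookup (\<Sum>as\<in>exponent_box N s. Poly_Mapping.single 0 (c as) * power_product fs as) w = 0"
    if w: "Poly_Mapping.keys w \<subseteq> Y" for w
  proof (cases "w \<in> T")
    case True
    then show ?thesis using c(2) lk by simp
  next
    \<comment> \<open>A monomial outside \<open>T\<close> exceeds the exponent bound in some
      variable and so occurs in no power product of the box.\<close>
    case False
    then obtain i where "\<not> Poly_Mapping.lookup w i \<le> N * \<delta> * s"
      using w unfolding T_def by blast
    then have "Poly_Mapping.lookup (power_product fs as) w = 0" if "as \<in> exponent_box N s" for as
      using lookup_power_product_bound[OF \<delta>, of as N w i] that
      unfolding s_def in_keys_iff by linarith
    then show ?thesis unfolding lk by (intro sum.neutral) auto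
  qed
  then show ?thesis using c(1) unfolding s_def by blast
qed

section \<open>Monomial ideals\<close>

definition multiples :: "monom set \<Rightarrow> monom set"
  where "multiples W = {w. \<exists>g\<in>W. \<forall>i. Poly_Mapping.lookup g i \<le> Poly_Mapping.lookup w i}"

lemma multiplesI: "g \<in> W \<Longrightarrow> (\<And>i. Poly_Mapping.lookup g i \<le> Poly_Mapping.lookup w i) \<Longrightarrow> w \<in> multiples W"
  unfolding multiples_def by blast

lemma multiplesE:
  assumes "w \<in> multiples W"
  obtains g where "g \<in> W" "\<And>i. Poly_Mapping.lookup g i \<le> Poly_Mapping.lookup w i"
  using assms unfolding multiples_def by blast

lemma self_in_multiples: "w \<in> W \<Longrightarrow> w \<in> multiples W"
  by (rule multiplesI[of w]) simp_all

lemma multiples_add: "w \<in> multiples W \<Longrightarrow> w + t \<in> multiples W"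
  by (elim multiplesE, rule multiplesI) (auto simp: lookup_add intro: trans_le_add1)

lemma sum_single_lookup:
  fixes p :: "'k::field mpoly"
  shows "(\<Sum>w\<in>Poly_Mapping.keys p. Poly_Mapping.single w (Poly_Mapping.lookup p w)) = p"
  by (rule poly_mapping_eqI) (simp add: lookup_sum lookup_single when_def in_keys_iff)

lemma ideal_monom_ideal:
  assumes "W \<subseteq> var_monoms n"
  shows "ideal (monom_ideal n W :: 'k::field mpoly set) (poly_ring n)"
proof -
  interpret S: cring "poly_ring n :: 'k mpoly ring" by (rule cring_poly_ring)
  show ?thesis
    unfolding monom_ideal_def using assms
    by (intro S.genideal_ideal) (auto intro!: carrier_single)
qed

text \<open>The polynomials supported on \<open>multiples W\<close> form an ideal containing the
  generators. Conversely, a polynomial is the sum of its terms, each a multiple of a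
  generator.\<close>

lemma mem_monom_ideal_iff:
  fixes p :: "'k::field mpoly"
  assumes W: "W \<subseteq> var_monoms n"
  shows "p \<in> monom_ideal n W \<longleftrightarrow> p \<in> carrier (poly_ring n) \<and> Poly_Mapping.keys p \<subseteq> multiples W"
proof
  interpret S: cring "poly_ring n :: 'k mpoly ring" by (rule cring_poly_ring)
  define K where "K = {p :: 'k mpoly. p \<in> carrier (poly_ring n) \<and> Poly_Mapping.keys p \<subseteq> multiples W}"
  have "ideal K (poly_ring n)"
  proof (rule poly_ring_idealI)
    fix p q :: "'k mpoly" assume "p \<in> K" "q \<in> K"
    then show "p + q \<in> K"
      using keys_add[of p q] by (auto simp: K_def carrier_add)
  next
    fix r p :: "'k mpoly" assume rp: "r \<in> carrier (poly_ring n)" "p \<in> K"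
    have "w \<in> multiples W" if w: "w \<in> Poly_Mapping.keys (r * p)" for w
    proof -
      obtain s t where "w = s + t" "t \<in> Poly_Mapping.keys p"
        using w keys_mult[of r p] by blast
      then show ?thesis
        using rp(2) multiples_add[of t W s] by (auto simp: K_def add.commute)
    qed
    then show "r * p \<in> K" using rp by (auto simp: K_def carrier_mult)
  qed (auto simp: K_def carrier_zero)
  moreover have "(\<lambda>w. Poly_Mapping.single w 1) ` W \<subseteq> K"
    using W by (auto simp: K_def self_in_multiples intro!: carrier_single)
  ultimately have "monom_ideal n W \<subseteq> K"
    unfolding monom_ideal_def by (rule S.genideal_minimal)
  then show "p \<in> carrier (poly_ring n) \<and> Poly_Mapping.keys p \<subseteq> multiples W" if "p \<in> monom_ideal n W"
    using that by (auto simp: K_def)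
next
  interpret S: cring "poly_ring n :: 'k mpoly ring" by (rule cring_poly_ring)
  assume p: "p \<in> carrier (poly_ring n) \<and> Poly_Mapping.keys p \<subseteq> multiples W"
  have "Poly_Mapping.single w (Poly_Mapping.lookup p w) \<in> monom_ideal n W"
    if "w \<in> Poly_Mapping.keys p" for w
  proof -
    obtain g where g: "g \<in> W" "\<And>i. Poly_Mapping.lookup g i \<le> Poly_Mapping.lookup w i"
      using p \<open>w \<in> _\<close> by (meson multiplesE subsetD)
    have w: "g + (w - g) = w" by (rule monom_add_diff[OF g(2)])
    have "w \<in> var_monoms n" using p that by (auto simp: carrier_poly_ring)
    then have "w - g \<in> var_monoms n" using w by (metis add_in_var_monoms_iff)
    moreover have "Poly_Mapping.single g (1 :: 'k) \<in> monom_ideal n W"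
      unfolding monom_ideal_def
      by (rule subsetD[OF S.genideal_self]) (use W g in \<open>auto intro!: carrier_single\<close>)
    ultimately have "Poly_Mapping.single (w - g) (Poly_Mapping.lookup p w) * Poly_Mapping.single g 1
        \<in> monom_ideal n W"
      by (intro ideal_mult[OF ideal_monom_ideal[OF W]] carrier_single)
    then show ?thesis using w by (simp add: mult_single add.commute)
  qed
  then have "(\<Sum>w\<in>Poly_Mapping.keys p. Poly_Mapping.single w (Poly_Mapping.lookup p w)) \<in> monom_ideal n W"
    by (rule ideal_sum[OF ideal_monom_ideal[OF W]])
  then show "p \<in> monom_ideal n W" by (simp only: sum_single_lookup)
qed

lemma genideal_insert_monom_ideal:
  assumes "W \<subseteq> var_monoms n" "v \<in> var_monoms n"
  shows "Idl\<^bsub>poly_ring n\<^esub> (insert (Poly_Mapping.single v 1) (monom_ideal n W)) =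
    (monom_ideal n (insert v W) :: 'k::field mpoly set)"
proof -
  interpret S: cring "poly_ring n :: 'k mpoly ring" by (rule cring_poly_ring)
  show ?thesis
    using S.genideal_Un_genideal[of "{Poly_Mapping.single v 1}" "(\<lambda>w. Poly_Mapping.single w 1) ` W"] assms
    by (auto simp: monom_ideal_def image_subset_iff subset_iff intro!: carrier_single)
qed

section \<open>The graded maximal ideal, and regular sequences modulo monomial ideals\<close>

lemma variables_subset_var_monoms: "(\<lambda>i. Poly_Mapping.single i 1) ` {1..n} \<subseteq> var_monoms n"
  by auto

lemma ideal_graded_max_ideal: "ideal (graded_max_ideal n :: 'k::field mpoly set) (poly_ring n)"
  unfolding graded_max_ideal_def by (rule ideal_monom_ideal[OF variables_subset_var_monoms])

text \<open>A monomial is divisible by a variable exactly when it is not 1, so only the constant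
  term obstructs membership.\<close>

lemma mem_graded_max_ideal_iff:
  fixes p :: "'k::field mpoly"
  shows "p \<in> graded_max_ideal n \<longleftrightarrow> p \<in> carrier (poly_ring n) \<and> Poly_Mapping.lookup p 0 = 0"
proof -
  have "w \<in> multiples ((\<lambda>i. Poly_Mapping.single i 1) ` {1..n}) \<longleftrightarrow> w \<noteq> 0" if w: "w \<in> var_monoms n" for w
  proof
    assume "w \<in> multiples ((\<lambda>i. Poly_Mapping.single i 1) ` {1..n})"
    then obtain i where "\<And>j. Poly_Mapping.lookup (Poly_Mapping.single i (1::nat)) j \<le> Poly_Mapping.lookup w j"
      by (auto elim!: multiplesE)
    from this[of i] show "w \<noteq> 0" by auto
  next
    assume "w \<noteq> 0"
    then obtain i where i: "Poly_Mapping.lookup w i \<noteq> 0"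
      by (metis lookup_zero poly_mapping_eqI)
    then have "i \<in> {1..n}" using w by (auto simp: var_monoms_def in_keys_iff subset_iff)
    then show "w \<in> multiples ((\<lambda>i. Poly_Mapping.single i 1) ` {1..n})"
      using i by (intro multiplesI[of "Poly_Mapping.single i 1"]) (auto simp: lookup_single when_def)
  qed
  then show ?thesis
    unfolding graded_max_ideal_def mem_monom_ideal_iff[OF variables_subset_var_monoms]
    by (auto simp: carrier_poly_ring subset_iff in_keys_iff)
qed

lemma genideal_neq_carrier:
  assumes "A \<subseteq> (graded_max_ideal n :: 'k::field mpoly set)"
  shows "Idl\<^bsub>poly_ring n\<^esub> A \<noteq> carrier (poly_ring n)"
proof -
  interpret S: cring "poly_ring n :: 'k mpoly ring" by (rule cring_poly_ring)
  have "Idl\<^bsub>poly_ring n\<^esub> A \<subseteq> graded_max_ideal n"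
    by (rule S.genideal_minimal[OF ideal_graded_max_ideal assms])
  then have "1 \<notin> Idl\<^bsub>poly_ring n\<^esub> A" by (auto simp: mem_graded_max_ideal_iff)
  then show ?thesis using carrier_one[where ?'k = 'k] by blast
qed

text \<open>The annihilator of the monomial \<open>e\<close> modulo the ideal is the prime generated by the variables
  outside \<open>Y\<close>, so the submodule generated by \<open>e\<close> is a polynomial ring in \<open>card Y\<close> variables. There
  more than \<open>card Y\<close> elements are algebraically dependent, whereas a regular sequence satisfies no
  polynomial relation on \<open>e\<close>.\<close>
lemma reg_seq_length_le:
  fixes fs :: "'k::field mpoly list"
  assumes W: "W \<subseteq> var_monoms n" and e: "e \<in> var_monoms n" and Y: "Y \<subseteq> {1..n}"
    and mult: "\<And>i. i \<in> {1..n} - Y \<Longrightarrow> e + Poly_Mapping.single i 1 \<in> multiples W"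
    and nmult: "\<And>w. Poly_Mapping.keys w \<subseteq> Y \<Longrightarrow> e + w \<notin> multiples W"
    and reg: "reg_seq (poly_ring n) (monom_ideal n W) fs" and fs: "set fs \<subseteq> graded_max_ideal n"
  shows "length fs \<le> card Y"
proof (rule ccontr)
  let ?K = "monom_ideal n W :: 'k mpoly set" and ?e = "Poly_Mapping.single e (1 :: 'k)"
  assume "\<not> length fs \<le> card Y"
  then obtain N c where c: "\<exists>as\<in>exponent_box N (length fs). c as \<noteq> 0"
    "\<And>w. Poly_Mapping.keys w \<subseteq> Y \<Longrightarrow> Poly_Mapping.lookup
      (\<Sum>as\<in>exponent_box N (length fs). Poly_Mapping.single 0 (c as) * power_product fs as) w = 0"
    using power_products_dependent[of Y fs] finite_subset[OF Y] by auto
  define F where "F = (\<Sum>as\<in>exponent_box N (length fs). Poly_Mapping.single 0 (c as) * power_product fs as)"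
  have "set fs \<subseteq> carrier (poly_ring n)"
    using fs ideal_carrier[OF ideal_graded_max_ideal] by blast
  then have Fc: "F \<in> carrier (poly_ring n)"
    unfolding F_def by (intro carrier_sum carrier_mult carrier_single carrier_power_product) simp_all
  \<comment> \<open>The relation \<open>c\<close> kills all monomials in the variables of
    \<open>Y\<close>, so \<open>w\<close> involves a variable outside \<open>Y\<close>, which
    carries \<open>e\<close> into the ideal.\<close>
  have "e + w \<in> multiples W" if "w \<in> Poly_Mapping.keys F" for w
  proof -
    have w: "w \<in> var_monoms n" using Fc that by (auto simp: carrier_poly_ring)
    have "\<not> Poly_Mapping.keys w \<subseteq> Y" using c(2)[of w] that by (auto simp: F_def in_keys_iff)
    then obtain i where "i \<in> Poly_Mapping.keys w" "i \<notin> Y" by blast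
    then have i: "i \<in> Poly_Mapping.keys w" "i \<in> {1..n} - Y"
      using w by (auto simp: var_monoms_def)
    then have "Poly_Mapping.single i 1 + (w - Poly_Mapping.single i 1) = w"
      by (intro monom_add_diff) (auto simp: lookup_single when_def in_keys_iff)
    then show ?thesis using multiples_add[OF mult[OF i(2)]] by (metis add.assoc)
  qed
  then have "?e * F \<in> ?K"
    unfolding mem_monom_ideal_iff[OF W]
    by (auto simp: keys_single_mult intro!: carrier_mult carrier_single e Fc)
  then have FK: "F * ?e \<in> ?K" by (simp add: mult.commute)
  have "?e \<notin> loc_ideal n (graded_max_ideal n) ?K"
  proof
    assume "?e \<in> loc_ideal n (graded_max_ideal n) ?K"
    then obtain q :: "'k mpoly" where q: "q \<in> graded_max_ideal n" "?e * (1 - q) \<in> ?K"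
      by (auto simp: loc_ideal_def mult.commute)
    \<comment> \<open>As \<open>q\<close> has no constant term, the monomial \<open>e\<close>
      survives in the product, yet it lies outside the ideal.\<close>
    have "Poly_Mapping.lookup (?e * (1 - q)) (e + 0) = 1"
      using q(1) unfolding lookup_single_mult by (simp add: lookup_minus mem_graded_max_ideal_iff)
    then have "e \<in> Poly_Mapping.keys (?e * (1 - q))" by (simp add: in_keys_iff)
    then show False using q(2) nmult[of 0] by (auto simp: mem_monom_ideal_iff[OF W])
  qed
  then show False
    using reg_seq_independent[OF ideal_graded_max_ideal ideal_monom_ideal[OF W] reg fs
        carrier_single[OF e] _ FK[unfolded F_def]] c(1) by blast
qed

text \<open>A variable absent from all generators can be cancelled. Once it is adjoined,
  distinctness keeps the remaining variables absent from the generators.\<close>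

lemma reg_seq_variables:
  assumes "distinct xs" "set xs \<subseteq> {1..n}" "W \<subseteq> var_monoms n"
    and "\<And>g i. g \<in> W \<Longrightarrow> i \<in> set xs \<Longrightarrow> Poly_Mapping.lookup g i = 0"
    and "reg_seq (poly_ring n) (monom_ideal n ((\<lambda>i. Poly_Mapping.single i 1) ` set xs \<union> W)) gs"
  shows "reg_seq (poly_ring n) (monom_ideal n W :: 'k::field mpoly set)
    (map (\<lambda>i. Poly_Mapping.single (Poly_Mapping.single i 1) 1) xs @ gs)"
  using assms
proof (induction xs arbitrary: W)
  case (Cons x xs)
  let ?x = "Poly_Mapping.single x 1 :: monom"
  have x: "?x \<in> var_monoms n" using Cons.prems(2) by simp
  have nzd: "w \<in> multiples W" if xw: "?x + w \<in> multiples W" for w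
  proof -
    obtain g where g: "g \<in> W" "\<And>i. Poly_Mapping.lookup g i \<le> Poly_Mapping.lookup (?x + w) i"
      using xw by (auto elim: multiplesE)
    show ?thesis
    proof (rule multiplesI[OF g(1)])
      fix i show "Poly_Mapping.lookup g i \<le> Poly_Mapping.lookup w i"
        using g(2)[of i] Cons.prems(4)[OF g(1), of x]
        by (cases "i = x") (auto simp: lookup_add lookup_single)
    qed
  qed
  have "\<forall>p\<in>carrier (poly_ring n). Poly_Mapping.single ?x (1 :: 'k) * p \<in> monom_ideal n W \<longrightarrow>
      p \<in> monom_ideal n W"
    unfolding mem_monom_ideal_iff[OF Cons.prems(3)] using nzd
    by (auto simp: keys_single_mult image_subset_iff)
  moreover have "reg_seq (poly_ring n) (monom_ideal n (insert ?x W) :: 'k mpoly set)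
      (map (\<lambda>i. Poly_Mapping.single (Poly_Mapping.single i 1) 1) xs @ gs)"
  proof (rule Cons.IH)
    show "Poly_Mapping.lookup g i = 0" if "g \<in> insert ?x W" "i \<in> set xs" for g i
      using that Cons.prems(1) Cons.prems(4)[of g i] by (auto simp: lookup_single when_def)
  qed (use Cons.prems x in auto)
  ultimately show ?case
    using genideal_insert_monom_ideal[OF Cons.prems(3) x, where ?'k = 'k] carrier_single[OF x, of 1] by simp
qed simp

text \<open>The product \<open>x * w\<close> of monomials is missing from \<open>(x - y) * p\<close>
  only if a term of \<open>y * p\<close> cancels it.\<close>

lemma monom_mult_diff_cases:
  fixes p :: "'k::field mpoly"
  assumes "x + w \<notin> Poly_Mapping.keys ((Poly_Mapping.single x 1 - Poly_Mapping.single y 1) * p)"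
    and "w \<in> Poly_Mapping.keys p"
  shows "\<exists>w'\<in>Poly_Mapping.keys p. x + w = y + w'"
proof -
  have "Poly_Mapping.lookup (Poly_Mapping.single y 1 * p) (x + w) = Poly_Mapping.lookup p w"
    using assms(1) lookup_single_mult[of x "1 :: 'k" p w]
    by (simp add: left_diff_distrib in_keys_iff lookup_minus)
  then have "x + w \<in> Poly_Mapping.keys (Poly_Mapping.single y 1 * p)"
    using assms(2) by (simp add: in_keys_iff)
  then show ?thesis by (auto simp: keys_single_mult)
qed

text \<open>Let \<open>A\<close> be the colon ideal by \<open>x\<close>. By the first hypothesis \<open>x\<close> is a nonzerodivisor modulo \<open>A\<close>,
  hence so is \<open>x - y\<close>, by comparison of leading terms; and \<open>x\<close> annihilates \<open>A\<close> modulo the ideal,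
  where \<open>x - y\<close> acts as \<open>-y\<close>.\<close>
lemma diff_monom_nonzerodivisor:
  fixes p :: "'k::field mpoly"
  assumes W: "W \<subseteq> var_monoms n" and xy: "y < x" "x \<in> var_monoms n" "y \<in> var_monoms n"
    and sq: "\<And>w. x + (x + w) \<in> multiples W \<Longrightarrow> x + w \<in> multiples W"
    and colon: "\<And>w. w \<in> var_monoms n \<Longrightarrow> x + w \<in> multiples W \<Longrightarrow> y + w \<in> multiples W \<Longrightarrow> w \<in> multiples W"
    and p: "p \<in> carrier (poly_ring n)"
    and K: "(Poly_Mapping.single x 1 - Poly_Mapping.single y 1) * p \<in> monom_ideal n W"
  shows "p \<in> monom_ideal n W"
proof -
  let ?D = "(Poly_Mapping.single x 1 - Poly_Mapping.single y 1) * p"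
  have DK: "Poly_Mapping.keys ?D \<subseteq> multiples W"
    using K unfolding mem_monom_ideal_iff[OF W] by blast
  define B where "B = {w \<in> Poly_Mapping.keys p. x + w \<notin> multiples W}"
  have "B = {}"
  proof (rule ccontr)
    assume "B \<noteq> {}"
    define w where "w = Max B"
    have fin: "finite B" unfolding B_def by simp
    have w: "w \<in> B" and w_max: "\<And>v. v \<in> B \<Longrightarrow> v \<le> w"
      using Max_in[OF fin \<open>B \<noteq> {}\<close>] Max_ge[OF fin] unfolding w_def by auto
    have "x + w \<notin> Poly_Mapping.keys ?D" "w \<in> Poly_Mapping.keys p"
      using w DK unfolding B_def by auto
    then obtain w' where w': "w' \<in> Poly_Mapping.keys p" "x + w = y + w'"
      using monom_mult_diff_cases by blast
    \<comment> \<open>Since \<open>y < x\<close>, the cancelling \<open>w'\<close> exceeds the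
      maximum of \<open>B\<close>, so \<open>x + w'\<close> is a multiple. Adding \<open>y\<close>
      gives \<open>x + (x + w)\<close>, and \<open>sq\<close> contradicts
      \<open>w \<in> B\<close>.\<close>
    have "w < w'"
    proof (rule ccontr)
      assume "\<not> w < w'"
      then have "y + w' \<le> y + w" by (simp add: add_left_mono)
      also have "\<dots> < x + w" using xy(1) by (rule add_strict_right_mono)
      finally show False using w'(2) by simp
    qed
    then have "w' \<notin> B" using w_max[of w'] by (meson leD)
    then have "x + w' \<in> multiples W" using w'(1) unfolding B_def by blast
    then have "(x + w') + y \<in> multiples W" by (rule multiples_add)
    also have "(x + w') + y = x + (x + w)" using w'(2) by (simp add: ac_simps)
    finally show False using sq w unfolding B_def by blast
  qed
  then have xB: "x + w \<in> multiples W" if "w \<in> Poly_Mapping.keys p" for w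
    using that unfolding B_def by blast
  have "Poly_Mapping.single x 1 * p \<in> monom_ideal n W"
    unfolding mem_monom_ideal_iff[OF W] using xB
    by (auto simp: keys_single_mult intro!: carrier_mult carrier_single xy p)
  from ideal_diff[OF ideal_monom_ideal[OF W] this K]
  have "Poly_Mapping.single y 1 * p \<in> monom_ideal n W" by (simp add: left_diff_distrib)
  then have "y + w \<in> multiples W" if "w \<in> Poly_Mapping.keys p" for w
    unfolding mem_monom_ideal_iff[OF W] using that by (auto simp: keys_single_mult)
  then show ?thesis
    unfolding mem_monom_ideal_iff[OF W] using xB p colon by (auto simp: carrier_poly_ring)
qed

lemma depth_eqI:
  assumes "cring R" "ideal I R"
    and "\<And>fs. reg_seq R I fs \<Longrightarrow> set fs \<subseteq> J \<Longrightarrow> length fs \<le> r"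
    and "reg_seq R I gs" "set gs \<subseteq> J" "length gs = r"
  shows "depth R J (quot_module R I) = enat r"
  unfolding depth_def regular_sequence_quot_module_iff[OF assms(1,2)]
proof (rule antisym)
  show "(SUP fs\<in>{fs. set fs \<subseteq> J \<and> reg_seq R I fs}. enat (length fs)) \<le> enat r"
    using assms(3) by (intro SUP_least) auto
  show "enat r \<le> (SUP fs\<in>{fs. set fs \<subseteq> J \<and> reg_seq R I fs}. enat (length fs))"
    using assms(4-6) by (intro SUP_upper2[of gs]) auto
qed

section \<open>Lexsegments\<close>

abbreviation (input) X :: "nat \<Rightarrow> monom" where "X i \<equiv> Poly_Mapping.single i 1"

lemma lookup_X: "Poly_Mapping.lookup (Poly_Mapping.single i (Suc 0)) k = (if k = i then 1 else 0)"
  by (simp add: lookup_single when_def)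

lemma X_neq_0: "Poly_Mapping.single i (Suc 0) \<noteq> 0"
  by (metis lookup_X lookup_zero zero_neq_one)

definition total_degree :: "nat \<Rightarrow> monom \<Rightarrow> nat"
  where "total_degree n w = (\<Sum>i\<in>{1..n}. Poly_Mapping.lookup w i)"

lemma total_degree_add [simp]: "total_degree n (v + w) = total_degree n v + total_degree n w"
  by (simp add: total_degree_def lookup_add sum.distrib)

lemma total_degree_single [simp]: "1 \<le> i \<Longrightarrow> i \<le> n \<Longrightarrow> total_degree n (Poly_Mapping.single i e) = e"
  by (simp add: total_degree_def lookup_single when_def)

lemma total_degree_mono:
  "(\<And>i. Poly_Mapping.lookup v i \<le> Poly_Mapping.lookup w i) \<Longrightarrow> total_degree n v \<le> total_degree n w"
  unfolding total_degree_def by (rule sum_mono)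

lemma sum_lookup_le_total_degree:
  "A \<subseteq> {1..n} \<Longrightarrow> (\<Sum>i\<in>A. Poly_Mapping.lookup w i) \<le> total_degree n w"
  unfolding total_degree_def by (rule sum_mono2) auto

lemma monomials_eq: "monomials n d = {w \<in> var_monoms n. total_degree n w = d}"
proof -
  have "(\<Sum>i\<in>Poly_Mapping.keys w. Poly_Mapping.lookup w i) = total_degree n w"
    if "Poly_Mapping.keys w \<subseteq> {1..n}" for w :: monom
    unfolding total_degree_def using that
    by (intro sum.mono_neutral_left) (auto simp: not_in_keys_iff_lookup_eq_zero)
  then show ?thesis by (auto simp: monomials_def var_monoms_def)
qed

lemma monom_eq_of_le:
  assumes "v \<in> monomials n d" "w \<in> monomials n d"
    and le: "\<And>i. Poly_Mapping.lookup v i \<le> Poly_Mapping.lookup w i"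
  shows "v = w"
proof (rule poly_mapping_eqI)
  fix i
  show "Poly_Mapping.lookup v i = Poly_Mapping.lookup w i"
  proof (cases "i \<in> {1..n}")
    case True
    have "(\<Sum>i\<in>{1..n}. Poly_Mapping.lookup v i) = (\<Sum>i\<in>{1..n}. Poly_Mapping.lookup w i)"
      using assms by (simp add: monomials_eq total_degree_def)
    then show ?thesis using le True by (rule sum_mono_inv) simp
  next
    case False
    then show ?thesis
      using assms lookup_eq_0_of_var_monoms[of _ n i] by (auto simp: monomials_eq)
  qed
qed

lemma monom_le_lookup_first:
  fixes v w :: monom
  assumes "v \<le> w" "\<And>i. i < k \<Longrightarrow> Poly_Mapping.lookup v i = Poly_Mapping.lookup w i"
  shows "Poly_Mapping.lookup v k \<le> Poly_Mapping.lookup w k"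
proof (rule ccontr)
  assume "\<not> ?thesis"
  then have "w < v" using assms(2) by (auto simp: monom_less_iff not_le intro!: exI[of _ k])
  then show False using assms(1) by simp
qed

lemma X_le_X: "i \<le> k \<Longrightarrow> X k \<le> X i"
  by (cases "i = k") (auto simp: monom_less_iff lookup_X intro!: less_imp_le exI[of _ i])

lemma X_plus_diff: "0 < Poly_Mapping.lookup w i \<Longrightarrow> X i + (w - X i) = w"
  by (intro monom_add_diff) (auto simp: lookup_X)

lemma multiples_Un: "multiples (V \<union> W) = multiples V \<union> multiples W"
  unfolding multiples_def by blast

lemma mem_multiples_variables_iff: "w \<in> multiples (X ` B) \<longleftrightarrow> (\<exists>b\<in>B. 0 < Poly_Mapping.lookup w b)"
proof
  assume "w \<in> multiples (X ` B)"
  then obtain b where b: "b \<in> B" "\<And>i. Poly_Mapping.lookup (X b) i \<le> Poly_Mapping.lookup w i"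
    by (auto elim: multiplesE)
  then show "\<exists>b\<in>B. 0 < Poly_Mapping.lookup w b"
    using b(2)[of b] by (intro bexI[OF _ b(1)]) (simp add: lookup_X)
next
  assume "\<exists>b\<in>B. 0 < Poly_Mapping.lookup w b"
  then obtain b where "b \<in> B" "0 < Poly_Mapping.lookup w b" by blast
  then show "w \<in> multiples (X ` B)" by (intro multiplesI[of "X b"]) (auto simp: lookup_X)
qed

text \<open>Here \<open>u'\<close> stands for \<open>u / x\<^sub>1\<close>.\<close>
locale lexsegment_data =
  fixes n d l :: nat and u' v :: monom
  assumes d: "2 \<le> d" and l: "2 \<le> l" "l \<le> n"
    and u': "u' \<in> monomials n (d - 1)" "\<And>i. i < l \<Longrightarrow> Poly_Mapping.lookup u' i = 0"
      "0 < Poly_Mapping.lookup u' l"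
    and v: "v \<in> monomials n d" "Poly_Mapping.lookup v 1 = 0"
    and less: "X n + u' < v"
begin

definition L :: "monom set" where "L = lexsegment n d (X 1 + u') v"

lemma lookup_0: "w \<in> monomials n e \<Longrightarrow> Poly_Mapping.lookup w 0 = 0"
  using lookup_eq_0_of_var_monoms[of w n 0] by (simp add: monomials_eq)

lemma u'_1: "Poly_Mapping.lookup u' (Suc 0) = 0"
  using u'(2)[of 1] l by simp

lemma u_mem: "X 1 + u' \<in> monomials n d"
  using u'(1) d l by (simp add: monomials_eq)

lemma L_subset: "L \<subseteq> var_monoms n"
  by (auto simp: L_def lexsegment_def monomials_eq)

lemma L_monomials: "g \<in> L \<Longrightarrow> g \<in> monomials n d"
  by (simp add: L_def lexsegment_def)

text \<open>Index 0 is no variable, so the comparison with \<open>u\<close> starts at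
  \<open>x1\<close>, which has exponent 1 in \<open>u\<close>.\<close>

lemma L_lookup_1:
  assumes "g \<in> L"
  shows "Poly_Mapping.lookup g 1 \<le> 1"
proof -
  have "Poly_Mapping.lookup g 1 \<le> Poly_Mapping.lookup (X 1 + u') 1"
    using assms lookup_0[OF u_mem] lookup_0[of g d]
    by (intro monom_le_lookup_first) (auto simp: L_def lexsegment_def)
  then show ?thesis using u'_1 by (simp add: lookup_add)
qed

text \<open>The lower end \<open>v\<close> imposes nothing on multiples of \<open>x1\<close>,
  because \<open>v\<close> is free of \<open>x1\<close>.\<close>

lemma L_with_x1:
  assumes "w \<in> monomials n (d - 1)" "w \<le> u'"
  shows "X 1 + w \<in> L"
proof -
  have w: "X 1 + w \<in> monomials n d" using assms(1) d l by (simp add: monomials_eq)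
  have "v < X 1 + w"
    using v lookup_0[OF w] lookup_0[OF v(1)]
    unfolding monom_less_iff by (intro exI[of _ 1]) (auto simp: lookup_add)
  then show ?thesis
    using w assms(2) by (auto simp: L_def lexsegment_def intro: add_left_mono)
qed

text \<open>The upper end imposes nothing on monomials free of \<open>x1\<close>, because
  \<open>u\<close> contains \<open>x1\<close>.\<close>

lemma L_without_x1:
  assumes "w \<in> monomials n d" "Poly_Mapping.lookup w 1 = 0" "v \<le> w"
  shows "w \<in> L"
proof -
  have "w < X 1 + u'"
    using assms(2) lookup_0[OF assms(1)] lookup_0[OF u_mem]
    unfolding monom_less_iff by (intro exI[of _ 1]) (auto simp: lookup_add)
  then show ?thesis using assms by (simp add: L_def lexsegment_def)
qed

lemma L_cases:
  assumes "g \<in> L"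
  obtains (with_x1) g' where "g = X 1 + g'" "g' \<le> u'" "g' \<in> monomials n (d - 1)"
      "\<And>i. i < l \<Longrightarrow> Poly_Mapping.lookup g' i = 0"
    | (without_x1) "Poly_Mapping.lookup g 1 = 0" "v \<le> g"
proof (cases "Poly_Mapping.lookup g 1 = 0")
  case True
  then show ?thesis using assms without_x1 by (simp add: L_def lexsegment_def)
next
  case False
  define g' where "g' = g - X 1"
  have g: "g = X 1 + g'" using X_plus_diff[of g 1] False by (simp add: g'_def)
  have le: "g' \<le> u'"
    using assms unfolding g L_def lexsegment_def by simp
  have g': "g' \<in> monomials n (d - 1)"
    using L_monomials[OF assms] d l unfolding g by (auto simp: monomials_eq)
  \<comment> \<open>Being at most \<open>u'\<close>, the monomial \<open>g'\<close> cannot start at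
    an earlier variable than \<open>u'\<close> does.\<close>
  have "i < l \<Longrightarrow> Poly_Mapping.lookup g' i = 0" for i
  proof (induction i rule: less_induct)
    case (less i)
    then have "Poly_Mapping.lookup g' i \<le> Poly_Mapping.lookup u' i"
      using u'(2) by (intro monom_le_lookup_first le) simp
    then show ?case using u'(2) less.prems by simp
  qed
  then show ?thesis using g le g' with_x1 by blast
qed

text \<open>If \<open>w\<close> is not in the ideal, generators \<open>x1 * g\<close> and
  \<open>xn * h\<close> divide \<open>x1 * w\<close> and \<open>xn * w\<close>, with
  \<open>g\<close> and \<open>h\<close> dividing \<open>w\<close>. If \<open>w = h\<close>, then
  \<open>g = h\<close> by degree and \<open>xn * h \<le> xn * u' < v\<close>, which is impossible.
  Otherwise some \<open>xi * h\<close> with \<open>i \<ge> 2\<close> divides \<open>w\<close>; it is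
  at least \<open>xn * h \<ge> v\<close>, hence a generator.\<close>

lemma colon_L:
  assumes w: "w \<in> var_monoms n" and "X 1 + w \<in> multiples L" "X n + w \<in> multiples L"
  shows "w \<in> multiples L"
proof (rule ccontr)
  assume neg: "w \<notin> multiples L"
  have not_le: "\<exists>i. Poly_Mapping.lookup w i < Poly_Mapping.lookup g i" if "g \<in> L" for g
    using neg that multiplesI[of g L w] by (metis not_le)
  obtain g1 where g1: "g1 \<in> L" "\<And>i. Poly_Mapping.lookup g1 i \<le> Poly_Mapping.lookup (X 1 + w) i"
    using assms(2) by (auto elim: multiplesE)
  obtain g2 where g2: "g2 \<in> L" "\<And>i. Poly_Mapping.lookup g2 i \<le> Poly_Mapping.lookup (X n + w) i"
    using assms(3) by (auto elim: multiplesE)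
  obtain i where "Poly_Mapping.lookup w i < Poly_Mapping.lookup g1 i" using not_le[OF g1(1)] by blast
  moreover from this have "i = 1"
    using g1(2)[of i] by (auto simp: lookup_add lookup_X split: if_splits)
  ultimately have w1: "Poly_Mapping.lookup w 1 = 0" and g11: "Poly_Mapping.lookup g1 1 \<noteq> 0"
    using L_lookup_1[OF g1(1)] by auto
  obtain g where g: "g1 = X 1 + g" "g \<le> u'" "g \<in> monomials n (d - 1)"
    using g1(1) g11 by (cases rule: L_cases) auto
  have gw: "Poly_Mapping.lookup g i \<le> Poly_Mapping.lookup w i" for i
    using g1(2)[of i] by (auto simp: g(1) lookup_add)
  obtain i where "Poly_Mapping.lookup w i < Poly_Mapping.lookup g2 i" using not_le[OF g2(1)] by blast
  moreover from this have "i = n"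
    using g2(2)[of i] by (auto simp: lookup_add lookup_X split: if_splits)
  ultimately have "0 < Poly_Mapping.lookup g2 n" by simp
  then obtain h where h: "g2 = X n + h" using X_plus_diff by metis
  have hw: "Poly_Mapping.lookup h i \<le> Poly_Mapping.lookup w i" for i
    using g2(2)[of i] by (auto simp: h lookup_add)
  have hm: "h \<in> monomials n (d - 1)"
    using L_monomials[OF g2(1)] d l unfolding h by (auto simp: monomials_eq)
  show False
  proof (cases "w = h")
    case True
    then have "g = h" using gw by (intro monom_eq_of_le[OF g(3) hm]) simp
    then have "g2 \<le> X n + u'" using g(2) h by (simp add: add_left_mono)
    then have "g2 < v" using less by simp
    moreover have "v \<le> g2" using g2(1) by (simp add: L_def lexsegment_def)
    ultimately show False by simp
  next
    case False
    then obtain i where i: "Poly_Mapping.lookup h i \<noteq> Poly_Mapping.lookup w i"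
      by (metis poly_mapping_eqI)
    then have lt: "Poly_Mapping.lookup h i < Poly_Mapping.lookup w i"
      using hw[of i] by simp
    then have "\<not> (i = 0 \<or> n < i)"
      using lookup_eq_0_of_var_monoms[OF w, of i] by (metis not_less0)
    moreover have "i \<noteq> 1" using lt w1 by auto
    ultimately have in2: "2 \<le> i" "i \<le> n" by auto
    have "X i + h \<in> L"
    proof (rule L_without_x1)
      show "X i + h \<in> monomials n d" using hm d in2 by (simp add: monomials_eq)
      show "Poly_Mapping.lookup (X i + h) 1 = 0"
        using hw[of 1] w1 in2 by (simp add: lookup_add lookup_X)
      have "v \<le> X n + h" using g2(1) h by (simp add: L_def lexsegment_def)
      also have "\<dots> \<le> X i + h" by (intro add_right_mono X_le_X in2)
      finally show "v \<le> X i + h" .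
    qed
    moreover have "Poly_Mapping.lookup (X i + h) k \<le> Poly_Mapping.lookup w k" for k
      using lt hw[of k] by (auto simp: lookup_add lookup_X)
    ultimately show False using neg multiplesI by blast
  qed
qed

text \<open>The sequence consists of the variables in \<open>xs\<close> followed by
  \<open>x1 - xn\<close>. For the latter, \<open>x1\<close> has exponent at most 1 in every
  generator, and \<open>colon_L\<close> survives adjoining \<open>xs\<close> because 1 and
  \<open>n\<close> are not in \<open>xs\<close>.\<close>

lemma exists_reg_seq:
  assumes xs: "distinct xs" "set xs \<subseteq> {2..<n}" "\<And>g i. g \<in> L \<Longrightarrow> i \<in> set xs \<Longrightarrow> Poly_Mapping.lookup g i = 0"
  shows "\<exists>gs. reg_seq (poly_ring n) (monom_ideal n L :: 'k::field mpoly set) gs \<and>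
    set gs \<subseteq> graded_max_ideal n \<and> length gs = Suc (length xs)"
proof (intro exI conjI)
  interpret S: cring "poly_ring n :: 'k mpoly ring" by (rule cring_poly_ring)
  let ?W = "X ` set xs \<union> L"
  define D :: "'k mpoly" where "D = Poly_Mapping.single (X 1) 1 - Poly_Mapping.single (X n) 1"
  let ?gs = "map (\<lambda>i. Poly_Mapping.single (X i) (1 :: 'k)) xs @ [D]"
  have Xm: "Poly_Mapping.single (X i) (1 :: 'k) \<in> graded_max_ideal n" if "i \<in> {1..n}" for i
    using that by (auto simp: mem_graded_max_ideal_iff lookup_single when_def X_neq_0 intro!: carrier_single)
  then have Dm: "D \<in> graded_max_ideal n"
    unfolding D_def using l by (intro ideal_diff[OF ideal_graded_max_ideal]) auto
  show gs: "set ?gs \<subseteq> graded_max_ideal n"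
    using Dm Xm xs(2) by fastforce
  have W: "?W \<subseteq> var_monoms n" using xs(2) L_subset by fastforce
  have W1: "Poly_Mapping.lookup g 1 \<le> 1" if "g \<in> ?W" for g
    using that L_lookup_1 by (auto simp: lookup_X)
  have L0: "0 \<notin> multiples ?W"
  proof
    assume "0 \<in> multiples ?W"
    then obtain g where g: "g \<in> ?W" "\<And>i. Poly_Mapping.lookup g i \<le> Poly_Mapping.lookup 0 i"
      by (rule multiplesE) (rule that)
    have "total_degree n g = 0" using g(2) by (simp add: total_degree_def)
    moreover have "total_degree n g \<noteq> 0"
      using g(1) L_monomials[of g] d xs(2) by (auto simp: monomials_eq)
    ultimately show False by simp
  qed
  have KW: "monom_ideal n ?W \<subseteq> (graded_max_ideal n :: 'k mpoly set)"
    using L0 unfolding mem_graded_max_ideal_iff subset_iff mem_monom_ideal_iff[OF W]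
    by (metis in_keys_iff)
  have "p \<in> monom_ideal n ?W" if "p \<in> carrier (poly_ring n)" "D * p \<in> monom_ideal n ?W" for p :: "'k mpoly"
  proof (rule diff_monom_nonzerodivisor[OF W _ _ _ _ _ that(1) that(2)[unfolded D_def]])
    show "X n < X 1" using l by (auto simp: monom_less_iff lookup_X intro!: exI[of _ 1])
    show "X 1 \<in> var_monoms n" "X n \<in> var_monoms n" using l by auto
    fix w
    show "X 1 + w \<in> multiples ?W" if sq: "X 1 + (X 1 + w) \<in> multiples ?W"
    proof -
      obtain g where g: "g \<in> ?W" "\<And>i. Poly_Mapping.lookup g i \<le> Poly_Mapping.lookup (X 1 + (X 1 + w)) i"
        using sq by (rule multiplesE) (rule that)
      show ?thesis
      proof (rule multiplesI[OF g(1)])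
        fix i show "Poly_Mapping.lookup g i \<le> Poly_Mapping.lookup (X 1 + w) i"
          using g(2)[of i] W1[OF g(1)] by (cases "i = 1") (auto simp: lookup_add lookup_X)
      qed
    qed
    assume w: "w \<in> var_monoms n" "X 1 + w \<in> multiples ?W" "X n + w \<in> multiples ?W"
    show "w \<in> multiples ?W"
    proof (cases "w \<in> multiples (X ` set xs)")
      case True
      then show ?thesis by (simp add: multiples_Un)
    next
      case False
      moreover have "1 \<notin> set xs" "n \<notin> set xs" using xs(2) by auto
      ultimately have "X 1 + w \<notin> multiples (X ` set xs)" "X n + w \<notin> multiples (X ` set xs)"
        unfolding mem_multiples_variables_iff by (auto simp: lookup_add lookup_X)
      then show ?thesis using w colon_L[of w] by (auto simp: multiples_Un)
    qed
  qed
  moreover have "Idl\<^bsub>poly_ring n\<^esub> (insert D (monom_ideal n ?W)) \<noteq> carrier (poly_ring n)"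
    using KW Dm by (intro genideal_neq_carrier) auto
  ultimately have "reg_seq (poly_ring n) (monom_ideal n ?W) [D]"
    using ideal_carrier[OF ideal_graded_max_ideal Dm] by simp
  then show "reg_seq (poly_ring n) (monom_ideal n L) ?gs"
    using xs by (intro reg_seq_variables L_subset) auto
  show "length ?gs = Suc (length xs)" by simp
qed

section \<open>Matching bounds for the depth, and the choice of \<open>e\<close> and
  \<open>Y\<close> in each case\<close>

lemma depth_eq:
  assumes "e \<in> var_monoms n" "Y \<subseteq> {1..n}"
    and "\<And>i. i \<in> {1..n} - Y \<Longrightarrow> e + X i \<in> multiples L"
    and "\<And>w. Poly_Mapping.keys w \<subseteq> Y \<Longrightarrow> e + w \<notin> multiples L"
    and "distinct xs" "set xs \<subseteq> {2..<n}" "\<And>g i. g \<in> L \<Longrightarrow> i \<in> set xs \<Longrightarrow> Poly_Mapping.lookup g i = 0"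
    and "card Y = Suc (length xs)"
  shows "depth (poly_ring n :: 'k::field mpoly ring) (graded_max_ideal n)
    (quot_module (poly_ring n) (monom_ideal n L)) = enat (card Y)"
proof -
  obtain gs where gs: "reg_seq (poly_ring n) (monom_ideal n L :: 'k mpoly set) gs"
    "set gs \<subseteq> graded_max_ideal n" "length gs = Suc (length xs)"
    using exists_reg_seq[OF assms(5-7)] by blast
  show ?thesis
    by (rule depth_eqI[OF cring_poly_ring ideal_monom_ideal[OF L_subset] _ gs(1,2)])
      (use reg_seq_length_le[OF L_subset assms(1-4)] gs(3) assms(8) in auto)
qed

text \<open>Here \<open>e = x1 * m\<close> with \<open>u' = x2 * m\<close>: for
  \<open>i \<ge> 2\<close> the monomial \<open>xi * m\<close> is at most \<open>u'\<close>. A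
  generator dividing \<open>e\<close> times a power of \<open>x1\<close> would already divide
  \<open>e\<close>, whose degree is only \<open>d - 1\<close>.\<close>

lemma depth_eq_1_if_l_eq_2:
  assumes "l = 2"
  shows "depth (poly_ring n :: 'k::field mpoly ring) (graded_max_ideal n)
    (quot_module (poly_ring n) (monom_ideal n L)) = 1"
proof -
  define m where "m = u' - X 2"
  have u'm: "u' = X 2 + m" using X_plus_diff[of u' 2] u'(3) assms by (simp add: m_def)
  have m: "m \<in> monomials n (d - 2)"
    using u'(1) l assms unfolding u'm by (auto simp: monomials_eq)
  have "depth (poly_ring n :: 'k mpoly ring) (graded_max_ideal n)
    (quot_module (poly_ring n) (monom_ideal n L)) = enat (card {1::nat})"
  proof (rule depth_eq[of "X 1 + m" _ "[]"])
    show "X 1 + m \<in> var_monoms n" using m l by (simp add: monomials_eq)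
    fix i assume i: "i \<in> {1..n} - {1}"
    have "X i + m \<le> u'" unfolding u'm using i by (intro add_right_mono X_le_X) auto
    moreover have "X i + m \<in> monomials n (d - 1)" using m i d by (auto simp: monomials_eq)
    ultimately have "X 1 + (X i + m) \<in> L" by (intro L_with_x1)
    then show "X 1 + m + X i \<in> multiples L"
      by (intro self_in_multiples) (simp add: ac_simps)
  next
    fix w :: monom assume w: "Poly_Mapping.keys w \<subseteq> {1}"
    show "X 1 + m + w \<notin> multiples L"
    proof
      assume "X 1 + m + w \<in> multiples L"
      then obtain g where g: "g \<in> L" "\<And>i. Poly_Mapping.lookup g i \<le> Poly_Mapping.lookup (X 1 + m + w) i"
        by (auto elim!: multiplesE)
      have "Poly_Mapping.lookup g i \<le> Poly_Mapping.lookup (X 1 + m) i" for i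
      proof (cases "i = 1")
        case True
        then show ?thesis using L_lookup_1[OF g(1)] by (simp add: lookup_add)
      next
        case False
        then have "Poly_Mapping.lookup w i = 0" using w by (auto simp: in_keys_iff)
        then show ?thesis using g(2)[of i] by (simp add: lookup_add)
      qed
      then have "total_degree n g \<le> total_degree n (X 1 + m)" by (rule total_degree_mono)
      then show False
        using L_monomials[OF g(1)] m d l by (simp add: monomials_eq)
    qed
  qed (use l in auto)
  then show ?thesis by (simp add: one_enat_def)
qed

text \<open>Here \<open>e = x2^(d-1)\<close>, and \<open>e * xi \<ge> e * xn \<ge> v\<close> for
  \<open>i \<ge> 2\<close>. A generator in \<open>x1\<close> and \<open>x2\<close> alone that
  contains \<open>x1\<close> has no \<open>x2\<close>, since \<open>l \<ge> 3\<close>, so its degree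
  is too small; one without \<open>x1\<close> needs \<open>x2^d\<close>.\<close>

lemma depth_eq_1_if_v_small:
  assumes "3 \<le> l" "v \<le> Poly_Mapping.single 2 (d - 1) + X n"
  shows "depth (poly_ring n :: 'k::field mpoly ring) (graded_max_ideal n)
    (quot_module (poly_ring n) (monom_ideal n L)) = 1"
proof -
  let ?e = "Poly_Mapping.single 2 (d - 1) :: monom"
  have "depth (poly_ring n :: 'k mpoly ring) (graded_max_ideal n)
    (quot_module (poly_ring n) (monom_ideal n L)) = enat (card {1::nat})"
  proof (rule depth_eq[of ?e _ "[]"])
    show "?e \<in> var_monoms n" using l by simp
    fix i assume i: "i \<in> {1..n} - {1}"
    have "?e + X i \<in> L"
    proof (rule L_without_x1)
      show "?e + X i \<in> monomials n d" using i d l by (auto simp: monomials_eq)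
      show "Poly_Mapping.lookup (?e + X i) 1 = 0" using i by (auto simp: lookup_add lookup_single)
      have "?e + X n \<le> ?e + X i" using i by (intro add_left_mono X_le_X) auto
      then show "v \<le> ?e + X i" by (rule order_trans[OF assms(2)])
    qed
    then show "?e + X i \<in> multiples L" by (rule self_in_multiples)
  next
    fix w :: monom assume w: "Poly_Mapping.keys w \<subseteq> {1}"
    show "?e + w \<notin> multiples L"
    proof
      assume "?e + w \<in> multiples L"
      then obtain g where g: "g \<in> L" "\<And>i. Poly_Mapping.lookup g i \<le> Poly_Mapping.lookup (?e + w) i"
        by (auto elim!: multiplesE)
      have w0: "Poly_Mapping.lookup w i = 0" if "i \<noteq> 1" for i using w that by (auto simp: in_keys_iff)
      have g2: "Poly_Mapping.lookup g 2 \<le> d - 1" using g(2)[of 2] w0 by (simp add: lookup_add)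
      have gi: "Poly_Mapping.lookup g i = 0" if "i \<noteq> 1" "i \<noteq> 2" for i
        using g(2)[of i] w0 that by (simp add: lookup_add lookup_single)
      have "d = (\<Sum>i\<in>{1..n}. Poly_Mapping.lookup g i)"
        using L_monomials[OF g(1)] by (simp add: monomials_eq total_degree_def)
      also have "\<dots> = (\<Sum>i\<in>{1,2}. Poly_Mapping.lookup g i)"
        using l gi by (intro sum.mono_neutral_right) auto
      finally have d_eq: "d = Poly_Mapping.lookup g 1 + Poly_Mapping.lookup g 2" by simp
      from g(1) show False
      proof (cases rule: L_cases)
        case (with_x1 g')
        then have "Poly_Mapping.lookup g 2 = 0" using assms(1) by (simp add: lookup_add lookup_X)
        then show False using d_eq L_lookup_1[OF g(1)] d by simp
      next
        case without_x1
        then show False using d_eq g2 d by simp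
      qed
    qed
  qed (use l in auto)
  then show ?thesis by (simp add: one_enat_def)
qed

section \<open>The case \<open>v = x2^(d-1) * xj\<close> with \<open>j < n\<close>, where
  \<open>j = 2\<close> stands for \<open>v = x2^d\<close>\<close>

context
  fixes j :: nat
  assumes l3: "3 \<le> l" and j: "2 \<le> j" "j < n" and vj: "v = Poly_Mapping.single 2 (d - 1) + X j"
begin

lemma v_le_lookup_2: "v \<le> g \<Longrightarrow> g \<in> monomials n e \<Longrightarrow> Poly_Mapping.lookup g 1 = 0 \<Longrightarrow>
    Poly_Mapping.lookup v 2 \<le> Poly_Mapping.lookup g 2"
  using lookup_0[of g e] lookup_0[OF v(1)] v(2)
  by (intro monom_le_lookup_first) (auto simp: less_2_cases_iff)

lemma v_le_lookup_j:
  assumes "v \<le> g" "g \<in> monomials n e" "Poly_Mapping.lookup g 1 = 0" "3 \<le> j"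
    and "Poly_Mapping.lookup g 2 = d - 1" "\<And>i. 3 \<le> i \<Longrightarrow> i < j \<Longrightarrow> Poly_Mapping.lookup g i = 0"
  shows "0 < Poly_Mapping.lookup g j"
proof -
  have "Poly_Mapping.lookup v j \<le> Poly_Mapping.lookup g j"
  proof (rule monom_le_lookup_first[OF assms(1)])
    fix i assume "i < j"
    then consider "i = 0" | "i = 1" | "i = 2" | "3 \<le> i" by linarith
    then show "Poly_Mapping.lookup v i = Poly_Mapping.lookup g i"
      using lookup_0[OF assms(2)] lookup_0[OF v(1)] v(2) assms(3-6) \<open>i < j\<close>
      by cases (auto simp: vj lookup_add lookup_single)
  qed
  then show ?thesis using assms(4) by (simp add: vj lookup_add lookup_X)
qed

text \<open>Generators with \<open>x1\<close> continue only from \<open>xl\<close> on. Those without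
  \<open>x1\<close> are at least \<open>v\<close>, so a factor \<open>xi\<close> with
  \<open>i > j\<close> would leave too little degree for the factors \<open>x2\<close> and
  \<open>xj\<close> of \<open>v\<close>.\<close>

lemma L_lookup_middle:
  assumes "g \<in> L" "j < i" "i < l"
  shows "Poly_Mapping.lookup g i = 0"
  using assms(1)
proof (cases rule: L_cases)
  case (with_x1 g')
  then show ?thesis using assms j by (simp add: lookup_add lookup_X)
next
  case without_x1
  note gm = L_monomials[OF assms(1)]
  have sum: "(\<Sum>i\<in>A. Poly_Mapping.lookup g i) \<le> d" if "A \<subseteq> {1..n}" for A
    using sum_lookup_le_total_degree[OF that, of g] gm by (simp add: monomials_eq)
  have g2: "Poly_Mapping.lookup v 2 \<le> Poly_Mapping.lookup g 2"
    by (rule v_le_lookup_2[OF without_x1(2) gm without_x1(1)])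
  show ?thesis
  proof (rule ccontr)
    assume gi: "Poly_Mapping.lookup g i \<noteq> 0"
    have le: "Poly_Mapping.lookup g 2 + Poly_Mapping.lookup g i \<le> d"
      using sum[of "{2, i}"] assms j l by auto
    \<comment> \<open>For \<open>j = 2\<close> the power \<open>x2^d\<close> already exhausts the
      degree.\<close>
    then have j3: "3 \<le> j" using g2 gi j d by (cases "j = 2") (auto simp: vj lookup_add lookup_X)
    then have g2: "Poly_Mapping.lookup g 2 = d - 1"
      using g2 gi le by (simp add: vj lookup_add lookup_X)
    have gk: "Poly_Mapping.lookup g k = 0" if "3 \<le> k" "k \<le> j" for k
      using sum[of "{2, i, k}"] that assms j l gi g2 d by auto
    show False
      using v_le_lookup_j[OF without_x1(2) gm without_x1(1) j3 g2] gk[of j] gk j3 by simp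
  qed
qed

text \<open>For \<open>l \<le> j\<close> the monomials in question avoid \<open>xl\<close>, so they
  are smaller than \<open>u'\<close>. For \<open>l > j\<close> take \<open>m = u' / xl\<close> and
  use \<open>xi \<le> xl\<close>.\<close>

lemma exists_socle_monomial:
  "\<exists>m \<in> monomials n (d - 2). Poly_Mapping.keys m \<subseteq> {max l (Suc j)..n} \<and>
    (\<forall>i\<in>{max l (Suc j)..n}. m + X i \<le> u')"
proof (cases "l \<le> j")
  case True
  have "Poly_Mapping.single n (d - 2) + X i < u'" if "Suc j \<le> i" for i
    unfolding monom_less_iff using u' True that j
    by (intro exI[of _ l]) (auto simp: lookup_add lookup_single)
  then show ?thesis using True j l
    by (intro bexI[of _ "Poly_Mapping.single n (d - 2)"]) (auto simp: monomials_eq intro: less_imp_le)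
next
  case False
  define m where "m = u' - X l"
  have u'm: "u' = m + X l" using X_plus_diff[of u' l] u'(3) by (simp add: m_def add.commute)
  have m: "m \<in> monomials n (d - 2)"
    using u'(1) l unfolding u'm by (auto simp: monomials_eq)
  have "Poly_Mapping.keys m \<subseteq> {l..n}"
  proof
    fix i assume i: "i \<in> Poly_Mapping.keys m"
    then have "i \<in> {1..n}" using m by (auto simp: monomials_eq var_monoms_def)
    moreover have "\<not> i < l"
      using i u'(2)[of i] by (auto simp: u'm lookup_add in_keys_iff)
    ultimately show "i \<in> {l..n}" by simp
  qed
  moreover have "\<forall>i\<in>{l..n}. m + X i \<le> u'"
    unfolding u'm by (intro ballI add_left_mono X_le_X) simp
  moreover have "max l (Suc j) = l" using False by simp
  ultimately show ?thesis using m by auto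
qed

text \<open>Multiplying \<open>e\<close> by \<open>xi\<close> gives a multiple of
  \<open>x2^(d-1) * xi \<ge> v\<close> for \<open>2 \<le> i \<le> j\<close>, and of
  \<open>x1 * m * xi\<close> with \<open>m * xi \<le> u'\<close> for \<open>i \<ge> s\<close>.
  Multiplying by variables in \<open>Y\<close> stays outside the ideal: a generator with
  \<open>x1\<close> would leave a divisor of \<open>m\<close> of too large degree, and one without
  \<open>x1\<close> would be smaller than \<open>v\<close>. Truncated subtraction gives the value 1
  for \<open>l \<le> j + 1\<close>.\<close>

lemma depth_eq_if_v_large:
  "depth (poly_ring n :: 'k::field mpoly ring) (graded_max_ideal n)
    (quot_module (poly_ring n) (monom_ideal n L)) = enat (Suc (l - Suc j))"
proof -
  define s where "s = max l (Suc j)"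
  obtain m where m: "m \<in> monomials n (d - 2)" "Poly_Mapping.keys m \<subseteq> {s..n}"
    "\<And>i. i \<in> {s..n} \<Longrightarrow> m + X i \<le> u'"
    using exists_socle_monomial unfolding s_def by blast
  define e where "e = X 1 + Poly_Mapping.single 2 (d - 1) + m"
  define Y where "Y = insert 1 {Suc j..<l}"
  have m0: "Poly_Mapping.lookup m i = 0" if "i < s" for i
    using m(2) that by (auto simp: in_keys_iff subset_iff)
  have card: "card Y = Suc (l - Suc j)" using j by (simp add: Y_def)
  have "depth (poly_ring n :: 'k mpoly ring) (graded_max_ideal n)
    (quot_module (poly_ring n) (monom_ideal n L)) = enat (card Y)"
  proof (rule depth_eq[of e _ "[Suc j..<l]"])
    show "e \<in> var_monoms n" using m(1) l by (simp add: e_def monomials_eq)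
    show "Y \<subseteq> {1..n}" using l by (auto simp: Y_def)
    show "card Y = Suc (length [Suc j..<l])" by (simp add: card)
    show "set [Suc j..<l] \<subseteq> {2..<n}" using l j by auto
    show "Poly_Mapping.lookup g i = 0" if "g \<in> L" "i \<in> set [Suc j..<l]" for g i
      using that L_lookup_middle by auto
  next
    fix i assume "i \<in> {1..n} - Y"
    then consider "2 \<le> i" "i \<le> j" | "s \<le> i" "i \<le> n"
      unfolding Y_def s_def by fastforce
    then show "e + X i \<in> multiples L"
    proof cases
      case 1
      have "Poly_Mapping.single 2 (d - 1) + X i \<in> L"
      proof (rule L_without_x1)
        show "Poly_Mapping.single 2 (d - 1) + X i \<in> monomials n d"
          using 1 j d l by (simp add: monomials_eq)
        show "Poly_Mapping.lookup (Poly_Mapping.single 2 (d - 1) + X i) 1 = 0"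
          using 1 by (simp add: lookup_add lookup_single)
        show "v \<le> Poly_Mapping.single 2 (d - 1) + X i"
          unfolding vj using 1 by (intro add_left_mono X_le_X)
      qed
      then have "(Poly_Mapping.single 2 (d - 1) + X i) + (X 1 + m) \<in> multiples L"
        by (intro multiples_add self_in_multiples)
      then show ?thesis by (simp add: e_def ac_simps)
    next
      case 2
      have "m + X i \<in> monomials n (d - 1)" using m(1) 2 d j by (auto simp: monomials_eq s_def)
      then have "X 1 + (m + X i) \<in> L" using m(3) 2 by (intro L_with_x1) auto
      then have "(X 1 + (m + X i)) + Poly_Mapping.single 2 (d - 1) \<in> multiples L"
        by (intro multiples_add self_in_multiples)
      then show ?thesis by (simp add: e_def ac_simps)
    qed
  next
    fix w :: monom assume w: "Poly_Mapping.keys w \<subseteq> Y"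
    have w0: "Poly_Mapping.lookup w i = 0" if "i \<notin> Y" for i
      using w that by (auto simp: in_keys_iff)
    show "e + w \<notin> multiples L"
    proof
      assume "e + w \<in> multiples L"
      then obtain g where g: "g \<in> L" "\<And>i. Poly_Mapping.lookup g i \<le> Poly_Mapping.lookup (e + w) i"
        by (auto elim!: multiplesE)
      have s3: "3 \<le> s" using l3 by (simp add: s_def)
      have g2: "Poly_Mapping.lookup g 2 \<le> d - 1"
        using g(2)[of 2] m0[of 2] w0[of 2] s3 j
        by (simp add: e_def Y_def lookup_add lookup_single)
      have gi: "Poly_Mapping.lookup g i = 0" if "3 \<le> i" "i \<le> j" for i
        using g(2)[of i] m0[of i] w0[of i] that
        by (simp add: e_def Y_def s_def lookup_add lookup_single)
      from g(1) show False
      proof (cases rule: L_cases)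
        case (with_x1 g')
        have "Poly_Mapping.lookup g' i \<le> Poly_Mapping.lookup m i" for i
        proof -
          consider "i < l" | "l \<le> i" "i < s" | "s \<le> i" by linarith
          then show ?thesis
          proof cases
            case 1
            then show ?thesis using with_x1(4) by simp
          next
            case 2
            then have "Poly_Mapping.lookup g i = 0" using l3 by (intro gi) (auto simp: s_def)
            then show ?thesis by (simp add: with_x1(1) lookup_add)
          next
            case 3
            then have "Poly_Mapping.lookup w i = 0"
              using l3 by (intro w0) (auto simp: Y_def s_def)
            then show ?thesis using g(2)[of i] 3 s3
              by (simp add: e_def with_x1(1) lookup_add lookup_single)
          qed
        qed
        then have "total_degree n g' \<le> total_degree n m" by (rule total_degree_mono)
        then show False using with_x1(3) m(1) d by (simp add: monomials_eq)
      next
        case without_x1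
        note gm = L_monomials[OF g(1)]
        have le: "Poly_Mapping.lookup v 2 \<le> Poly_Mapping.lookup g 2"
          by (rule v_le_lookup_2[OF without_x1(2) gm without_x1(1)])
        then have j3: "3 \<le> j" using g2 j d by (cases "j = 2") (auto simp: vj lookup_add lookup_X)
        then have "Poly_Mapping.lookup g 2 = d - 1"
          using g2 le by (simp add: vj lookup_add lookup_X)
        then show False
          using v_le_lookup_j[OF without_x1(2) gm without_x1(1) j3] gi[of j] gi j3 by simp
      qed
    qed
  qed simp
  then show ?thesis by (simp add: card)
qed

end

text \<open>At the first difference \<open>k\<close> from \<open>x2^(d-1) * xn\<close>, the exponent
  in \<open>v\<close> is larger. Degree \<open>d\<close> then leaves only
  \<open>x2^(d-1) * xk\<close>, and \<open>k = n\<close> would require \<open>xn\<close> squared on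
  top of \<open>x2^(d-1)\<close>.\<close>

lemma v_large_cases:
  assumes "3 \<le> l" "\<not> v \<le> Poly_Mapping.single 2 (d - 1) + X n"
  obtains j where "2 \<le> j" "j < n" "v = Poly_Mapping.single 2 (d - 1) + X j"
proof -
  let ?t = "Poly_Mapping.single 2 (d - 1) + X n"
  obtain k where k: "Poly_Mapping.lookup ?t k < Poly_Mapping.lookup v k"
    "\<And>i. i < k \<Longrightarrow> Poly_Mapping.lookup ?t i = Poly_Mapping.lookup v i"
    using assms(2) by (auto simp: not_le monom_less_iff)
  have sum: "(\<Sum>i\<in>A. Poly_Mapping.lookup v i) \<le> d" if "A \<subseteq> {1..n}" for A
    using sum_lookup_le_total_degree[OF that, of v] v(1) by (simp add: monomials_eq)
  have "k \<noteq> 0" "k \<noteq> 1" using k(1) lookup_0[OF v(1)] v(2) by (metis less_nat_zero_code)+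
  then have k2: "2 \<le> k" by simp
  have kn: "k \<le> n"
    using k(1) lookup_eq_0_of_var_monoms[of v n k] v(1) by (force simp: monomials_eq not_less)
  have v2: "Poly_Mapping.lookup v 2 = d - 1" if "k \<noteq> 2"
    using k(2)[of 2] k2 that assms(1) l by (simp add: lookup_add lookup_single)
  have "k \<noteq> n"
  proof
    assume "k = n"
    then have "1 < Poly_Mapping.lookup v n" "k \<noteq> 2"
      using k(1) assms(1) l by (auto simp: lookup_add lookup_single)
    then show False using v2 sum[of "{2, n}"] \<open>k = n\<close> d l by auto
  qed
  moreover have "Poly_Mapping.single 2 (d - 1) + X k = v"
  proof (rule monom_eq_of_le[OF _ v(1)])
    show "Poly_Mapping.single 2 (d - 1) + X k \<in> monomials n d"
      using k2 kn d l by (simp add: monomials_eq)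
    fix i show "Poly_Mapping.lookup (Poly_Mapping.single 2 (d - 1) + X k) i \<le> Poly_Mapping.lookup v i"
      using k(1) v2 by (cases "k = 2") (auto simp: lookup_add lookup_single when_def)
  qed
  ultimately show ?thesis using that[of k] k2 kn by simp
qed

end

theorem proposition3p7:
  fixes n d l q :: nat and a b :: "nat \<Rightarrow> nat" and u v :: monom
    and S :: "'k::field mpoly ring" and I :: "'k mpoly set"
  assumes "d \<ge> 2"
    and "2 \<le> l" "l \<le> n" "2 \<le> q" "q \<le> n"
    and "a l > 0" "b q > 0"
    and "u = Poly_Mapping.single 1 1 + (\<Sum>i=l..n. Poly_Mapping.single i (a i))"
    and "v = (\<Sum>i=q..n. Poly_Mapping.single i (b i))"
    and "u \<in> monomials n d" "v \<in> monomials n d"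
    and "Poly_Mapping.single n 1 + (u - Poly_Mapping.single 1 1) < v"
    and "S = poly_ring n"
    and "I = monom_ideal n (lexsegment n d u v)"
  shows "(v = Poly_Mapping.single 2 d \<and> l \<ge> 4 \<longrightarrow>
            depth S (graded_max_ideal n) (quot_module S I) = enat (l - 2)) \<and>
         (\<forall>j. 3 \<le> j \<and> j \<le> n - 2 \<and>
              v = Poly_Mapping.single 2 (d - 1) + Poly_Mapping.single j 1 \<and> l \<ge> j + 2 \<longrightarrow>
            depth S (graded_max_ideal n) (quot_module S I) = enat (l - j)) \<and>
         (\<not> (v = Poly_Mapping.single 2 d \<and> l \<ge> 4) \<and>
          \<not> (\<exists>j. 3 \<le> j \<and> j \<le> n - 2 \<and>
               v = Poly_Mapping.single 2 (d - 1) + Poly_Mapping.single j 1 \<and> l \<ge> j + 2) \<longrightarrow>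
            depth S (graded_max_ideal n) (quot_module S I) = 1)"
proof -
  define u' where "u' = (\<Sum>i=l..n. Poly_Mapping.single i (a i))"
  have u: "u = X 1 + u'" using assms(8) by (simp add: u'_def)
  have lookup_u': "Poly_Mapping.lookup u' i = (if i \<in> {l..n} then a i else 0)" for i
    by (simp add: u'_def lookup_sum lookup_single when_def)
  have lookup_v: "Poly_Mapping.lookup v i = (if i \<in> {q..n} then b i else 0)" for i
    by (simp add: assms(9) lookup_sum lookup_single when_def)
  interpret lexsegment_data n d l u' v
  proof
    show "u' \<in> monomials n (d - 1)" using assms(1,10) assms(2,3) by (auto simp: u monomials_eq)
    show "X n + u' < v" using assms(12) by (simp add: u)
  qed (use assms(1-7,11) in \<open>auto simp: lookup_u' lookup_v\<close>)
  define D where "D = depth S (graded_max_ideal n) (quot_module S I)"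
  have D: "D = depth (poly_ring n :: 'k mpoly ring) (graded_max_ideal n)
      (quot_module (poly_ring n) (monom_ideal n L))"
    by (simp add: D_def assms(13,14) L_def u)
  \<comment> \<open>One formula serves (a) with \<open>j = 2\<close>, (b), and the part of (c) with
    large \<open>v\<close>.\<close>
  have large: "D = enat (Suc (l - Suc j))"
    if "3 \<le> l" "2 \<le> j" "j < n" "v = Poly_Mapping.single 2 (d - 1) + X j" for j
    unfolding D by (rule depth_eq_if_v_large[OF that])
  have pow: "Poly_Mapping.single 2 (d - 1) + X 2 = Poly_Mapping.single 2 d"
    using assms(1) by (simp flip: single_add)
  have a: "D = enat (l - 2)" if "v = Poly_Mapping.single 2 d" "l \<ge> 4"
    using large[of 2] that pow assms(3) by (simp add: Suc_diff_Suc numeral_eq_Suc)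
  have b: "D = enat (l - j)"
    if "3 \<le> j" "j \<le> n - 2" "v = Poly_Mapping.single 2 (d - 1) + X j" "l \<ge> j + 2" for j
    using large[of j] that assms(3) by (simp add: Suc_diff_Suc)
  have c: "D = 1"
    if "\<not> (v = Poly_Mapping.single 2 d \<and> l \<ge> 4)"
      "\<not> (\<exists>j. 3 \<le> j \<and> j \<le> n - 2 \<and> v = Poly_Mapping.single 2 (d - 1) + X j \<and> l \<ge> j + 2)"
  proof -
    consider "l = 2" | "3 \<le> l" "v \<le> Poly_Mapping.single 2 (d - 1) + X n"
      | "3 \<le> l" "\<not> v \<le> Poly_Mapping.single 2 (d - 1) + X n" using assms(2) by linarith
    then show ?thesis
    proof cases
      case 1
      then show ?thesis unfolding D by (rule depth_eq_1_if_l_eq_2)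
    next
      case 2
      then show ?thesis unfolding D by (rule depth_eq_1_if_v_small)
    next
      case 3
      then obtain j where j: "2 \<le> j" "j < n" "v = Poly_Mapping.single 2 (d - 1) + X j"
        by (rule v_large_cases)
      \<comment> \<open>Otherwise (a) applies for \<open>j = 2\<close>, and (b) for
        \<open>j \<ge> 3\<close>, where \<open>l \<le> n\<close> yields
        \<open>j \<le> n - 2\<close>. So the formula collapses to 1.\<close>
      have "l < j + 2"
      proof (rule ccontr)
        assume "\<not> l < j + 2"
        then show False using that j pow assms(3) by (cases "j = 2") auto
      qed
      then show ?thesis using large[OF 3(1) j] by (simp add: one_enat_def)
    qed
  qed
  show ?thesis using a b c unfolding D_def by blast
qed

end
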